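(* Let $p>5$ be a prime and $r\ge 2$ an integer. Then \[\sum_{\substack{l_1+l_2+\cdots+l_5=p^{r}\\ l_1,\dots,l_5\in\mathcal{P}_p}}\frac{1}{l_1l_2l_3l_4l_5}\equiv -\frac{5!}{6}\,p^{r-1}B_{p-5}\pmod{p^{r}}.\]
   Context: $\mathcal{P}_p$ denotes the set of positive integers prime to $p$. $B_n$ is the $n$-th Bernoulli number, defined by $\frac{x}{e^x-1}=\sum_{n\ge 0}B_n\frac{x^n}{n!}$. The congruence is in the ring of rationals whose denominators are prime to $p$. *)

theory Defs
  imports
    Complex_Main
    "HOL-Computational_Algebra.Primes"
    "HOL-Computational_Algebra.Formal_Power_Series"
begin

definition prime_to :: "nat \<Rightarrow> nat set" where
  "prime_to p = {n. 0 < n \<and> coprime n p}"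

text \<open>
  The Bernoulli numbers are read off the exponential generating function, taken as a formal
  power series over the rationals. The divisor \<open>fps_exp 1 - 1\<close> is not a unit (it has zero
  constant coefficient), but it divides \<open>fps_X\<close>; see \<open>bernoulli_generating_function\<close>.
  In this convention \<open>bernoulli 1 = - 1 / 2\<close>.
\<close>

definition bernoulli :: "nat \<Rightarrow> rat" where
  "bernoulli n = fact n * fps_nth (fps_X / (fps_exp 1 - 1)) n"

lemma bernoulli_generating_function:
  "Abs_fps (\<lambda>n. bernoulli n / fact n) * (fps_exp 1 - 1) = fps_X"
proof -
  have nz: "fps_exp 1 - 1 \<noteq> (0 :: rat fps)"
  proof
    assume "fps_exp 1 - 1 = (0 :: rat fps)"
    then have "fps_nth (fps_exp 1 - 1) 1 = fps_nth (0 :: rat fps) 1" by simp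
    then show False by simp
  qed
  have "subdegree (fps_exp 1 - 1 :: rat fps) = 1"
    by (rule subdegreeI) simp_all
  then have "(fps_exp 1 - 1 :: rat fps) dvd fps_X"
    using nz by (simp add: fps_dvd_iff)
  moreover have "Abs_fps (\<lambda>n. bernoulli n / fact n) = fps_X / (fps_exp 1 - 1)"
    by (simp add: fps_eq_iff bernoulli_def)
  ultimately show ?thesis by simp
qed

text \<open>
  The ring of rationals with denominator prime to \<open>p\<close>. Note that \<open>quotient_of\<close> returns the
  reduced fraction with positive denominator.
\<close>

definition p_integral :: "nat \<Rightarrow> rat set" where
  "p_integral p = {x. coprime (snd (quotient_of x)) (int p)}"

definition p_integral_cong :: "nat \<Rightarrow> rat \<Rightarrow> rat \<Rightarrow> rat \<Rightarrow> bool" where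
  "p_integral_cong p a b m \<longleftrightarrow>
     a \<in> p_integral p \<and> b \<in> p_integral p \<and> (\<exists>c \<in> p_integral p. a - b = m * c)"

end

theory Submission
  imports Defs "HOL-Number_Theory.Residues"
begin

text \<open>
  Let \<open>f = \<Sum> X^l / l\<close>, summed over the \<open>l\<close> prime to \<open>p\<close>, and let \<open>U N\<close> (\<open>comp_sum\<close>) be the coefficient of \<open>X^N\<close>
  in \<open>f^5\<close>, so that the sum in question is \<open>U (p^r)\<close>. Put \<open>Q = p^r\<close> with \<open>r \<ge> 1\<close>, let \<open>g\<close> be the part of \<open>f\<close>
  of degree below \<open>Q\<close>, and let \<open>S a\<close> (\<open>comp_sum_below\<close>) be the coefficient of \<open>X^(a Q)\<close> in \<open>g^5\<close>. Modulo \<open>Q\<close> the series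
  \<open>f\<close> is \<open>g / (1 - X^Q)\<close>, and its first-order correction does not contribute to the coefficient of
  \<open>X^(m p Q)\<close> modulo \<open>p Q\<close>; hence \<open>U (m p Q) \<equiv> \<Sum>a. (m p - a + 4 choose 4) S a\<close>. Together with
  \<open>S (5 - a) \<equiv> - S a\<close> modulo \<open>Q\<close> this becomes
  \<open>U (m p Q) \<equiv> m p (4/3 U Q - 1/6 U (2 Q))\<close> modulo \<open>p Q\<close>. For \<open>r \<ge> 2\<close> induction gives
  \<open>U (2 Q) \<equiv> 2 U Q\<close>, so each further power of \<open>p\<close> only multiplies \<open>U\<close> by \<open>p\<close>, whereas
  \<open>U (2 p) \<equiv> 3 U p\<close> modulo \<open>p\<close> produces the factor \<open>5/6\<close> in the step from \<open>p\<close> to \<open>p^2\<close>.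

  For the base case, the coefficients of powers of \<open>- ln (1 - X)\<close> are elementary symmetric functions
  of \<open>1, 1/2, 1/3, \<dots>\<close>, which Newton's identities reduce to \<open>H k = \<Sum>j<p. 1/j^k\<close> (\<open>inv_power_sum\<close>); one gets
  \<open>p U p \<equiv> - 30 H 4\<close> modulo \<open>p^2\<close>. Finally \<open>5 H 4 \<equiv> 4 \<Sum>j<p. j^(p-5) \<equiv> 4 p B\<^bsub>p-5\<^esub>\<close> modulo \<open>p^2\<close>.
\<close>

unbundle fps_syntax

section \<open>The ring of \<open>p\<close>-integral rationals\<close>

locale padic =
  fixes p :: nat
  assumes prime_p: "prime p"
begin

definition pideal :: "nat \<Rightarrow> rat set" where
  "pideal k = {of_nat p ^ k * c | c. c \<in> p_integral p}"

lemma p_gt_1: "p > 1" and p_pos: "p > 0"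
  using prime_p prime_gt_1_nat by (auto simp: prime_gt_0_nat)

text \<open>Any denominator prime to \<open>p\<close> will do: if \<open>n / d\<close> is the
  reduced form of \<open>a / b\<close>, then \<open>a d = n b\<close> and coprimality make
  \<open>d\<close> divide \<open>b\<close>.\<close>

lemma p_integralI:
  assumes "coprime b (int p)" "b \<noteq> 0"
  shows "of_int a / of_int b \<in> p_integral p"
proof -
  obtain n d where q: "quotient_of (of_int a / of_int b) = (n, d)" by force
  have d: "d > 0" and nd: "coprime n d" and e: "of_int a / of_int b = (of_int n / of_int d :: rat)"
    using q quotient_of_denom_pos quotient_of_coprime quotient_of_div by blast+
  have "(of_int (a * d) :: rat) = of_int (n * b)"
    using e d assms(2) by (simp add: field_simps)
  then have "a * d = n * b" by (simp only: of_int_eq_iff)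
  then have "d dvd b"
    using nd by (metis coprime_commute coprime_dvd_mult_right_iff dvd_triv_right)
  then have "coprime d (int p)" using assms(1) by (meson coprime_divisors dvd_refl)
  then show ?thesis by (simp add: p_integral_def q)
qed

lemma p_integralE:
  assumes "x \<in> p_integral p"
  obtains a b where "x = of_int a / of_int b" "coprime b (int p)" "b \<noteq> 0"
proof -
  obtain n d where q: "quotient_of x = (n, d)" by force
  have "d > 0" "x = of_int n / of_int d"
    using q quotient_of_denom_pos quotient_of_div by blast+
  then show ?thesis using that[of n d] assms q by (simp add: p_integral_def)
qed

lemma pint_of_int [simp, intro]: "of_int a \<in> p_integral p"
  using p_integralI[of 1 a] by simp

lemma pint_of_nat [simp, intro]: "of_nat a \<in> p_integral p"
  using pint_of_int[of "int a"] by simp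

lemma pint_numeral [simp, intro]:
  "0 \<in> p_integral p" "1 \<in> p_integral p" "numeral v \<in> p_integral p"
  using pint_of_nat[of 0] pint_of_nat[of 1] pint_of_nat[of "numeral v"] by simp_all

lemma pint_add [intro]:
  assumes "x \<in> p_integral p" "y \<in> p_integral p"
  shows "x + y \<in> p_integral p"
proof -
  obtain a b where 1: "x = of_int a / of_int b" "coprime b (int p)" "b \<noteq> 0"
    using assms p_integralE by blast
  obtain c d where 2: "y = of_int c / of_int d" "coprime d (int p)" "d \<noteq> 0"
    using assms p_integralE by blast
  have "x + y = of_int (a * d + c * b) / of_int (b * d)"
    using 1 2 by (simp add: field_simps)
  then show ?thesis using p_integralI[of "b * d" "a * d + c * b"] 1 2 by simp
qed

lemma pint_mult [intro]:
  assumes "x \<in> p_integral p" "y \<in> p_integral p"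
  shows "x * y \<in> p_integral p"
proof -
  obtain a b where 1: "x = of_int a / of_int b" "coprime b (int p)" "b \<noteq> 0"
    using assms p_integralE by blast
  obtain c d where 2: "y = of_int c / of_int d" "coprime d (int p)" "d \<noteq> 0"
    using assms p_integralE by blast
  have "x * y = of_int (a * c) / of_int (b * d)" using 1 2 by simp
  then show ?thesis using p_integralI[of "b * d" "a * c"] 1 2 by simp
qed

lemma pint_uminus [intro]: "x \<in> p_integral p \<Longrightarrow> - x \<in> p_integral p"
  using pint_mult[of "of_int (-1)" x] pint_of_int[of "-1"] by simp

lemma pint_diff [intro]: "x \<in> p_integral p \<Longrightarrow> y \<in> p_integral p \<Longrightarrow> x - y \<in> p_integral p"
  using pint_add[of x "- y"] by auto

lemma pint_power [intro]: "x \<in> p_integral p \<Longrightarrow> x ^ n \<in> p_integral p"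
  by (induction n) auto

lemma pint_sum [intro]: "(\<And>i. i \<in> A \<Longrightarrow> f i \<in> p_integral p) \<Longrightarrow> sum f A \<in> p_integral p"
  by (induction A rule: infinite_finite_induct) auto

lemma pint_divide_nat [intro]:
  assumes "x \<in> p_integral p" "\<not> p dvd n"
  shows "x / of_nat n \<in> p_integral p"
proof -
  have "n \<noteq> 0" using assms by (intro notI) simp
  moreover have "coprime (int n) (int p)"
    using assms prime_p by (metis coprime_int_iff prime_imp_coprime coprime_commute)
  ultimately have "1 / of_nat n \<in> p_integral p"
    using p_integralI[of "int n" 1] by simp
  then show ?thesis using pint_mult[OF assms(1)] by fastforce
qed

lemmas pints = pint_add pint_diff pint_mult pint_uminus pint_power pint_of_nat pint_of_int pint_numeral

section \<open>Powers of the ideal generated by \<open>p\<close>\<close>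

lemma pideal_0: "pideal 0 = p_integral p"
  by (auto simp: pideal_def)

lemma pidealI: "c \<in> p_integral p \<Longrightarrow> of_nat p ^ k * c \<in> pideal k"
  by (auto simp: pideal_def)

lemma pideal_zero [simp, intro]: "0 \<in> pideal k"
  using pidealI[of 0 k] by simp

lemma pideal_add [intro]: "x \<in> pideal k \<Longrightarrow> y \<in> pideal k \<Longrightarrow> x + y \<in> pideal k"
  by (auto simp: pideal_def simp flip: distrib_left)

lemma pideal_diff [intro]: "x \<in> pideal k \<Longrightarrow> y \<in> pideal k \<Longrightarrow> x - y \<in> pideal k"
  by (auto simp: pideal_def simp flip: right_diff_distrib)

lemma pideal_uminus [intro]: "x \<in> pideal k \<Longrightarrow> - x \<in> pideal k"
  using pideal_diff[of 0 k x] by simp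

lemma pideal_sum [intro]: "(\<And>i. i \<in> A \<Longrightarrow> f i \<in> pideal k) \<Longrightarrow> sum f A \<in> pideal k"
  by (induction A rule: infinite_finite_induct) auto

lemma pideal_mult:
  assumes "x \<in> pideal j" "y \<in> pideal k"
  shows "x * y \<in> pideal (j + k)"
proof -
  obtain c d where "x = of_nat p ^ j * c" "y = of_nat p ^ k * d" "c \<in> p_integral p" "d \<in> p_integral p"
    using assms by (auto simp: pideal_def)
  then have "x * y = of_nat p ^ (j + k) * (c * d)" "c * d \<in> p_integral p"
    by (auto simp: power_add)
  then show ?thesis by (auto simp: pideal_def)
qed

lemma pideal_mult_integral: "x \<in> pideal k \<Longrightarrow> c \<in> p_integral p \<Longrightarrow> c * x \<in> pideal k" "x \<in> pideal k \<Longrightarrow> c \<in> p_integral p \<Longrightarrow> x * c \<in> pideal k"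
  using pideal_mult[of c 0 x k] pideal_mult[of x k c 0] by (auto simp: pideal_0)

lemma pideal_mono:
  assumes "x \<in> pideal k" "j \<le> k"
  shows "x \<in> pideal j"
proof -
  obtain c where c: "x = of_nat p ^ k * c" "c \<in> p_integral p"
    using assms by (auto simp: pideal_def)
  then have "x = of_nat p ^ j * (of_nat p ^ (k - j) * c)"
    using assms(2) by (simp flip: mult.assoc power_add)
  moreover have "of_nat p ^ (k - j) * c \<in> p_integral p" using c by auto
  ultimately show ?thesis unfolding pideal_def by blast
qed

lemma pideal_integral: "x \<in> pideal k \<Longrightarrow> x \<in> p_integral p"
  using pideal_mono[of x k 0] by (simp add: pideal_0)

lemma pideal_divide_nat: "x \<in> pideal k \<Longrightarrow> \<not> p dvd n \<Longrightarrow> x / of_nat n \<in> pideal k"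
  using pideal_mult_integral(1)[of x k "1 / of_nat n"] by auto

lemma pideal_divide_p:
  assumes "x \<in> pideal (k + j)"
  shows "x / of_nat p ^ j \<in> pideal k"
  using assms p_pos by (auto simp: pideal_def power_add)

lemma p_power_pideal [simp, intro]: "of_nat p ^ k \<in> pideal k"
  using pidealI[of 1 k] by simp

lemma p_pideal [simp, intro]: "of_nat p \<in> pideal 1" "of_nat p \<in> pideal (Suc 0)"
  using p_power_pideal[of 1] by simp_all

text \<open>Only the difference is constrained; the integrality of both sides that
  \<open>p_integral_cong\<close> demands is tracked separately and added by
  \<open>p_integral_cong_iff\<close>.\<close>

definition pcong :: "nat \<Rightarrow> rat \<Rightarrow> rat \<Rightarrow> bool" where
  "pcong k a b \<longleftrightarrow> a - b \<in> pideal k"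

lemma pcong_refl [simp, intro]: "pcong k a a"
  by (simp add: pcong_def)

lemma pcong_sym: "pcong k a b \<Longrightarrow> pcong k b a"
  using pideal_uminus[of "a - b" k] by (simp add: pcong_def)

lemma pcong_trans [trans]: "pcong k a b \<Longrightarrow> pcong k b c \<Longrightarrow> pcong k a c"
  using pideal_add[of "a - b" k "b - c"] by (simp add: pcong_def)

lemma pcong_add: "pcong k a b \<Longrightarrow> pcong k c d \<Longrightarrow> pcong k (a + c) (b + d)"
  using pideal_add[of "a - b" k "c - d"] by (simp add: pcong_def algebra_simps)

lemma pcong_diff: "pcong k a b \<Longrightarrow> pcong k c d \<Longrightarrow> pcong k (a - c) (b - d)"
  using pideal_diff[of "a - b" k "c - d"] by (simp add: pcong_def algebra_simps)

lemma pcong_sum: "(\<And>i. i \<in> A \<Longrightarrow> pcong k (f i) (g i)) \<Longrightarrow> pcong k (sum f A) (sum g A)"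
  using pideal_sum[of A "\<lambda>i. f i - g i" k] by (simp add: pcong_def sum_subtractf)

lemma pcong_mult_left: "pcong k a b \<Longrightarrow> c \<in> p_integral p \<Longrightarrow> pcong k (c * a) (c * b)"
  using pideal_mult_integral(1)[of "a - b" k c] by (simp add: pcong_def algebra_simps)

lemma pcong_mult:
  assumes "pcong k a b" "pcong k c d" "c \<in> p_integral p" "b \<in> p_integral p"
  shows "pcong k (a * c) (b * d)"
proof -
  have "a * c - b * d = c * (a - b) + b * (c - d)" by (simp add: algebra_simps)
  then show ?thesis using assms pideal_mult_integral(1) pideal_add unfolding pcong_def by presburger
qed

lemma pcong_mono: "pcong k a b \<Longrightarrow> j \<le> k \<Longrightarrow> pcong j a b"
  using pideal_mono by (auto simp: pcong_def)

lemma p_integral_cong_iff: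
  "p_integral_cong p a b (of_nat p ^ k) \<longleftrightarrow> a \<in> p_integral p \<and> b \<in> p_integral p \<and> pcong k a b"
  by (auto simp: p_integral_cong_def pcong_def pideal_def)

end

section \<open>Coefficients of fifth powers of formal power series\<close>

text \<open>One round of expanding a power into a sum over tuples. The index type \<open>'b\<close>
  and its size \<open>s\<close> are arbitrary, so each use prepends one more component.\<close>

lemma fps_mult_nth_tuples:
  fixes f g :: "'a::comm_ring_1 fps" and s :: "'b \<Rightarrow> nat"
  assumes g: "\<And>n. g $ n = (\<Sum>t\<in>{t. s t = n}. w t)" and fin: "\<And>n. finite {t. s t = n}"
  shows "(f * g) $ n = (\<Sum>(i, t)\<in>{(i, t). i + s t = n}. f $ i * w t)"
    and "finite {(i, t). i + s t = n}"
proof -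
  have *: "{(i, t). i + s t = n} = (SIGMA i:{0..n}. {t. s t = n - i})"
    by auto
  show "finite {(i, t). i + s t = n}"
    unfolding * by (intro finite_SigmaI fin) auto
  show "(f * g) $ n = (\<Sum>(i, t)\<in>{(i, t). i + s t = n}. f $ i * w t)"
    unfolding * by (subst sum.Sigma[symmetric]) (auto simp: fin fps_mult_nth g sum_distrib_left)
qed

definition tuples5 :: "nat \<Rightarrow> (nat \<times> nat \<times> nat \<times> nat \<times> nat) set" where
  "tuples5 n = {(i, j, k, l, m). i + j + k + l + m = n}"

lemma fps_power5_nth:
  fixes f :: "'a::comm_ring_1 fps"
  shows "(f ^ 5) $ n = (\<Sum>(i, j, k, l, m)\<in>tuples5 n. f $ i * f $ j * f $ k * f $ l * f $ m)"
    and "finite (tuples5 n)"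
proof -
  \<comment> \<open>The start is a single index whose size is itself; the later rounds repack the
    new pair as a longer tuple pattern.\<close>
  have 1: "f $ n = (\<Sum>t\<in>{t. t = n}. f $ t)" "finite {t. t = n}" for n by auto
  note 2 = fps_mult_nth_tuples(1)[where f = f, OF 1] fps_mult_nth_tuples(2)[OF 1]
  have 2: "(f * f) $ n = (\<Sum>t\<in>{t. (\<lambda>(i, j). i + j) t = n}. (\<lambda>(i, j). f $ i * f $ j) t)"
    "finite {t. (\<lambda>(i, j). i + j) t = n}" for n
    using 2[where n = n] by (simp_all add: case_prod_unfold)
  note 3 = fps_mult_nth_tuples(1)[where f = f, OF 2] fps_mult_nth_tuples(2)[OF 2]
  have 3: "(f * (f * f)) $ n = (\<Sum>t\<in>{t. (\<lambda>(i, j, k). i + (j + k)) t = n}. (\<lambda>(i, j, k). f $ i * (f $ j * f $ k)) t)"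
    "finite {t. (\<lambda>(i, j, k). i + (j + k)) t = n}" for n
    using 3[where n = n] by (simp_all add: case_prod_unfold)
  note 4 = fps_mult_nth_tuples(1)[where f = f, OF 3] fps_mult_nth_tuples(2)[OF 3]
  have 4: "(f * (f * (f * f))) $ n = (\<Sum>t\<in>{t. (\<lambda>(i, j, k, l). i + (j + (k + l))) t = n}. (\<lambda>(i, j, k, l). f $ i * (f $ j * (f $ k * f $ l))) t)"
    "finite {t. (\<lambda>(i, j, k, l). i + (j + (k + l))) t = n}" for n
    using 4[where n = n] by (simp_all add: case_prod_unfold)
  note 5 = fps_mult_nth_tuples(1)[where f = f, OF 4] fps_mult_nth_tuples(2)[OF 4]
  have 5: "(f * (f * (f * (f * f)))) $ n = (\<Sum>t\<in>tuples5 n. (\<lambda>(i, j, k, l, m). f $ i * (f $ j * (f $ k * (f $ l * f $ m)))) t)"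
    "finite (tuples5 n)"
    using 5[where n = n] by (simp_all add: case_prod_unfold tuples5_def add.assoc)
  then show "finite (tuples5 n)" by simp
  show "(f ^ 5) $ n = (\<Sum>(i, j, k, l, m)\<in>tuples5 n. f $ i * f $ j * f $ k * f $ l * f $ m)"
    using 5(1) by (simp add: eval_nat_numeral mult.assoc)
qed

text \<open>The expansion of \<open>1 / (1 - X^Q)^(k+1)\<close>.\<close>

definition geom_fps :: "nat \<Rightarrow> nat \<Rightarrow> rat fps" where
  "geom_fps Q k = Abs_fps (\<lambda>n. if Q dvd n then of_nat (n div Q + k choose k) else 0)"

lemma one_minus_X_power_nth:
  fixes A :: "rat fps"
  shows "((1 - fps_X ^ Q) * A) $ n = A $ n - (if n < Q then 0 else A $ (n - Q))"
  by (simp add: left_diff_distrib fps_X_power_mult_nth)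

text \<open>The factor \<open>1 - X^Q\<close> takes differences of coefficients at distance
  \<open>Q\<close>; by Pascal's rule it turns \<open>geom_fps Q (Suc k)\<close> into
  \<open>geom_fps Q k\<close>.\<close>

lemma geom_fps_inverse:
  assumes "Q > 0"
  shows "(1 - fps_X ^ Q) ^ Suc k * geom_fps Q k = 1"
proof (induction k)
  case 0
  show ?case
    using assms by (auto simp: fps_eq_iff one_minus_X_power_nth geom_fps_def dvd_minus_self)
next
  case (Suc k)
  have "(1 - fps_X ^ Q) * geom_fps Q (Suc k) = geom_fps Q k"
  proof (rule fps_ext)
    fix n
    show "((1 - fps_X ^ Q) * geom_fps Q (Suc k)) $ n = geom_fps Q k $ n"
    proof (cases "n < Q")
      case True
      then show ?thesis
        using assms by (auto simp: one_minus_X_power_nth geom_fps_def)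
    next
      case False
      then have "n div Q = Suc ((n - Q) div Q)" using assms by (simp add: le_div_geq)
      then show ?thesis
        using False assms by (auto simp: one_minus_X_power_nth geom_fps_def dvd_minus_self)
    qed
  qed
  then show ?case using Suc by (simp only: power_Suc2 mult.assoc)
qed

text \<open>\<open>geom_fps\<close> vanishes off the multiples of \<open>Q\<close>, so in degree
  \<open>N Q\<close> only the coefficients of \<open>A\<close> at multiples of \<open>Q\<close> are
  seen.\<close>

lemma mult_geom_fps_nth:
  assumes "Q > 0"
  shows "(A * geom_fps Q k) $ (N * Q) = (\<Sum>a\<le>N. A $ (a * Q) * of_nat (N - a + k choose k))"
proof -
  have "(A * geom_fps Q k) $ (N * Q) = (\<Sum>i\<in>{0..N * Q}. A $ i * geom_fps Q k $ (N * Q - i))"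
    by (simp add: fps_mult_nth)
  also have "\<dots> = (\<Sum>i\<in>(\<lambda>a. a * Q) ` {..N}. A $ i * geom_fps Q k $ (N * Q - i))"
  proof (rule sum.mono_neutral_right)
    show "\<forall>i\<in>{0..N * Q} - (\<lambda>a. a * Q) ` {..N}. A $ i * geom_fps Q k $ (N * Q - i) = 0"
    proof
      fix i assume i: "i \<in> {0..N * Q} - (\<lambda>a. a * Q) ` {..N}"
      have "\<not> Q dvd N * Q - i"
      proof
        assume "Q dvd N * Q - i"
        then have "Q dvd i" using i by (metis DiffD1 atLeastAtMost_iff dvd_diffD1 dvd_triv_right)
        then show False using i assms by auto
      qed
      then show "A $ i * geom_fps Q k $ (N * Q - i) = 0" by (simp add: geom_fps_def)
    qed
  qed auto
  also have "\<dots> = (\<Sum>a\<le>N. A $ (a * Q) * geom_fps Q k $ (N * Q - a * Q))"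
    using assms by (subst sum.reindex) (auto simp: inj_on_def)
  also have "\<dots> = (\<Sum>a\<le>N. A $ (a * Q) * of_nat (N - a + k choose k))"
    using assms by (intro sum.cong) (auto simp: geom_fps_def simp flip: diff_mult_distrib)
  finally show ?thesis .
qed

definition fps_supported :: "rat fps \<Rightarrow> nat \<Rightarrow> nat \<Rightarrow> bool" where
  "fps_supported A u v \<longleftrightarrow> (\<forall>n. A $ n \<noteq> 0 \<longrightarrow> u \<le> n \<and> n \<le> v)"

text \<open>A nonzero coefficient of the product needs a nonzero term in the convolution, so the
  degree bounds add up.\<close>

lemma fps_supported_mult:
  assumes "fps_supported A u v" "fps_supported B u' v'"
  shows "fps_supported (A * B) (u + u') (v + v')"
  unfolding fps_supported_def
proof (intro allI impI)
  fix n assume "(A * B) $ n \<noteq> 0"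
  then obtain i where "i \<le> n" "A $ i * B $ (n - i) \<noteq> 0"
    unfolding fps_mult_nth using sum.not_neutral_contains_not_neutral by (metis (no_types, lifting) atLeastAtMost_iff)
  then have "u \<le> i" "i \<le> v" "u' \<le> n - i" "n - i \<le> v'" "i \<le> n"
    using assms by (auto simp: fps_supported_def)
  then show "u + u' \<le> n \<and> n \<le> v + v'" by linarith
qed

lemma fps_supported_power: "fps_supported A u v \<Longrightarrow> fps_supported (A ^ k) (k * u) (k * v)"
proof (induction k)
  case 0
  then show ?case by (auto simp: fps_supported_def)
next
  case (Suc k)
  then show ?case using fps_supported_mult[of A u v "A ^ k"] by simp
qed

section \<open>Passing from \<open>p^r\<close> to \<open>p^(r+1)\<close>\<close>

context padic
begin

text \<open>The series \<open>f\<close> of the overview; \<open>inv_fps_below Q\<close> is its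
  truncation \<open>g\<close>. Index 0 counts as divisible by \<open>p\<close>, so there is no
  constant term.\<close>

definition inv_fps :: "rat fps" where
  "inv_fps = Abs_fps (\<lambda>n. if p dvd n then 0 else 1 / of_nat n)"

definition comp_sum :: "nat \<Rightarrow> rat" where
  "comp_sum N = (inv_fps ^ 5) $ N"

definition inv_fps_below :: "nat \<Rightarrow> rat fps" where
  "inv_fps_below Q = Abs_fps (\<lambda>n. if p dvd n \<or> Q \<le> n then 0 else 1 / of_nat n)"

definition comp_sum_below :: "nat \<Rightarrow> nat \<Rightarrow> rat" where
  "comp_sum_below Q a = (inv_fps_below Q ^ 5) $ (a * Q)"

text \<open>The ring of power series over the \<open>p\<close>-integral rationals; its closure
  properties make the remainders of expansions integral without a look at single
  coefficients.\<close>

definition integral_fps :: "rat fps set" where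
  "integral_fps = {A. \<forall>n. A $ n \<in> p_integral p}"

lemma integral_fps_add: "A \<in> integral_fps \<Longrightarrow> B \<in> integral_fps \<Longrightarrow> A + B \<in> integral_fps"
  by (auto simp: integral_fps_def)

lemma integral_fps_mult: "A \<in> integral_fps \<Longrightarrow> B \<in> integral_fps \<Longrightarrow> A * B \<in> integral_fps"
  by (auto simp: integral_fps_def fps_mult_nth)

lemma integral_fps_of_nat: "of_nat n \<in> integral_fps"
  by (auto simp: integral_fps_def fps_of_nat[symmetric])

lemma integral_fps_power: "A \<in> integral_fps \<Longrightarrow> A ^ n \<in> integral_fps"
  using integral_fps_of_nat[of 1] by (induction n) (auto intro: integral_fps_mult)

lemmas integral_fps_intros = integral_fps_add integral_fps_mult integral_fps_power integral_fps_of_nat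

lemma inv_fps_integral: "inv_fps \<in> integral_fps"
  by (auto simp: inv_fps_def integral_fps_def)

lemma inv_fps_below_integral: "inv_fps_below Q \<in> integral_fps"
  by (auto simp: inv_fps_below_def integral_fps_def)

lemma comp_sum_integral: "comp_sum N \<in> p_integral p"
  using integral_fps_power[OF inv_fps_integral, of 5] by (simp add: comp_sum_def integral_fps_def)

text \<open>Tuples with an entry divisible by \<open>p\<close>, in particular with an entry 0, drop
  out because \<open>inv_fps\<close> vanishes there.\<close>

lemma comp_sum_eq_sum:
  "comp_sum N = (\<Sum>(l1, l2, l3, l4, l5) \<in> {(l1, l2, l3, l4, l5).
        l1 + l2 + l3 + l4 + l5 = N \<and>
        l1 \<in> prime_to p \<and> l2 \<in> prime_to p \<and> l3 \<in> prime_to p \<and>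
        l4 \<in> prime_to p \<and> l5 \<in> prime_to p}.
      1 / (of_nat l1 * of_nat l2 * of_nat l3 * of_nat l4 * of_nat l5))"
proof -
  have dvd: "p dvd n \<longleftrightarrow> n \<notin> prime_to p" for n
  proof (cases "n = 0")
    case False
    then show ?thesis
      using prime_p p_gt_1 unfolding prime_to_def
      by (metis (mono_tags, lifting) coprime_absorb_right coprime_commute gr0I mem_Collect_eq
          nat_dvd_1_iff_1 nat_neq_iff prime_imp_coprime)
  qed (auto simp: prime_to_def)
  show ?thesis
    unfolding comp_sum_def fps_power5_nth
  proof (rule sum.mono_neutral_cong_right[OF fps_power5_nth(2)], goal_cases)
    case 2
    show ?case by (clarsimp simp: tuples5_def inv_fps_def dvd) (auto split: if_splits)
  qed (auto simp: tuples5_def inv_fps_def dvd)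
qed

lemma one_minus_fps_X_power_mult_cancel:
  assumes "A * (1 - fps_X ^ Q) ^ Suc k = B" "Q > 0"
  shows "A = B * geom_fps Q k"
  using geom_fps_inverse[OF assms(2), of k] by (simp add: assms(1)[symmetric] mult.assoc)

section \<open>Expansion of \<open>comp_sum\<close> at multiples of \<open>Q = p^r\<close>\<close>

context
  fixes r Q :: nat
  assumes r: "r \<ge> 1" and Q: "Q = p ^ r"
begin

lemma Q_pos: "Q > 0"
  using Q p_pos by simp

lemma p_dvd_Q: "p dvd Q"
  using Q r by (simp add: dvd_power)

lemma Q_pideal: "of_nat Q \<in> pideal r"
  using Q by simp

lemma p_dvd_mod_Q: "p dvd n mod Q \<longleftrightarrow> p dvd n"
  using p_dvd_Q by (metis dvd_mod_iff)

lemma p_dvd_diff_Q: "Q \<le> n \<Longrightarrow> p dvd n - Q \<longleftrightarrow> p dvd n"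
  using p_dvd_Q dvd_diffD1[of p Q n] by (meson dvd_diff_nat dvd_diffD)

text \<open>Replacing every \<open>l\<close> by \<open>Q - l\<close> negates each of the five factors modulo \<open>Q\<close>.\<close>

lemma comp_sum_below_reflect:
  assumes "a \<le> 5"
  shows "comp_sum_below Q a + comp_sum_below Q (5 - a) \<in> pideal r"
proof -
  define Y where "Y = {l. l < Q \<and> \<not> p dvd l}"
  define T where "T b = {(i, j, k, l, m). i + j + k + l + m = b * Q \<and> i \<in> Y \<and> j \<in> Y \<and> k \<in> Y \<and> l \<in> Y \<and> m \<in> Y}" for b
  have comp_sum_below_eq: "comp_sum_below Q b = (\<Sum>(i, j, k, l, m)\<in>T b. inv_fps_below Q $ i * inv_fps_below Q $ j * inv_fps_below Q $ k * inv_fps_below Q $ l * inv_fps_below Q $ m)" for b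
    unfolding comp_sum_below_def fps_power5_nth(1)
  proof (rule sum.mono_neutral_right[OF fps_power5_nth(2)], goal_cases)
    case 2
    show ?case by (clarsimp simp: tuples5_def inv_fps_below_def T_def Y_def) (auto split: if_splits)
  qed (auto simp: tuples5_def T_def)
  have Y: "Q - l \<in> Y" "Q - (Q - l) = l" "l \<le> Q" if "l \<in> Y" for l
  proof -
    have l: "l < Q" "\<not> p dvd l" "l \<noteq> 0" using that by (auto simp: Y_def intro!: gr0I)
    show "Q - (Q - l) = l" "l \<le> Q" using l by auto
    moreover have "\<not> p dvd Q - l"
      using l p_dvd_Q dvd_diffD1[of p Q l] by auto
    ultimately show "Q - l \<in> Y" using l by (auto simp: Y_def)
  qed
  have five: "(5 - a) * Q = 5 * Q - a * Q"
    by (simp add: diff_mult_distrib)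
  have eq: "comp_sum_below Q (5 - a) = (\<Sum>(i, j, k, l, m)\<in>T a. inv_fps_below Q $ (Q - i) * inv_fps_below Q $ (Q - j) * inv_fps_below Q $ (Q - k) * inv_fps_below Q $ (Q - l) * inv_fps_below Q $ (Q - m))"
    unfolding comp_sum_below_eq
  proof (rule sum.reindex_bij_witness[where i = "\<lambda>(i, j, k, l, m). (Q - i, Q - j, Q - k, Q - l, Q - m)"
        and j = "\<lambda>(i, j, k, l, m). (Q - i, Q - j, Q - k, Q - l, Q - m)"], goal_cases)
    case (2 t)
    obtain i j k l m where t: "t = (i, j, k, l, m)" by (cases t) auto
    have "i \<in> Y" "j \<in> Y" "k \<in> Y" "l \<in> Y" "m \<in> Y" "i + j + k + l + m = 5 * Q - a * Q"
      using 2 t five by (auto simp: T_def)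
    moreover have "i \<le> Q" "j \<le> Q" "k \<le> Q" "l \<le> Q" "m \<le> Q" "a * Q \<le> 5 * Q"
      using calculation Y(3) assms by auto
    ultimately have "(Q - i) + (Q - j) + (Q - k) + (Q - l) + (Q - m) = a * Q" by linarith
    then show ?case using Y(1) \<open>i \<in> Y\<close> \<open>j \<in> Y\<close> \<open>k \<in> Y\<close> \<open>l \<in> Y\<close> \<open>m \<in> Y\<close>
      by (simp add: T_def t)
  next
    case (4 t)
    obtain i j k l m where t: "t = (i, j, k, l, m)" by (cases t) auto
    have "i \<in> Y" "j \<in> Y" "k \<in> Y" "l \<in> Y" "m \<in> Y" "i + j + k + l + m = a * Q"
      using 4 t by (auto simp: T_def)
    moreover have "i \<le> Q" "j \<le> Q" "k \<le> Q" "l \<le> Q" "m \<le> Q"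
      using calculation Y(3) by auto
    ultimately show ?case by (auto simp: T_def t Y(1) five)
  qed (auto simp: T_def Y)
  have inv_fps_below_refl: "pcong r (inv_fps_below Q $ (Q - l)) (- (inv_fps_below Q $ l))" if "l \<in> Y" for l
  proof -
    have l: "l < Q" "\<not> p dvd l" "\<not> p dvd Q - l" "l > 0"
      using that Y(1)[OF that] by (auto simp: Y_def intro!: gr0I)
    have "inv_fps_below Q $ (Q - l) - - (inv_fps_below Q $ l) = of_nat Q * (1 / of_nat (Q - l) / of_nat l)"
      using l by (simp add: inv_fps_below_def of_nat_diff field_simps)
    also have "\<dots> \<in> pideal r"
      using l by (intro pideal_mult_integral Q_pideal pint_divide_nat) auto
    finally show ?thesis by (simp add: pcong_def)
  qed
  have int: "inv_fps_below Q $ l \<in> p_integral p" for l using inv_fps_below_integral by (simp add: integral_fps_def)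
  have "pcong r (comp_sum_below Q (5 - a)) (- comp_sum_below Q a)"
    unfolding eq unfolding comp_sum_below_eq sum_negf[symmetric]
  proof (rule pcong_sum, clarify)
    fix i j k l m assume "(i, j, k, l, m) \<in> T a"
    then have "i \<in> Y" "j \<in> Y" "k \<in> Y" "l \<in> Y" "m \<in> Y" by (auto simp: T_def)
    then have "pcong r (inv_fps_below Q $ (Q - i) * inv_fps_below Q $ (Q - j) * inv_fps_below Q $ (Q - k) * inv_fps_below Q $ (Q - l) * inv_fps_below Q $ (Q - m))
      (- (inv_fps_below Q $ i) * - (inv_fps_below Q $ j) * - (inv_fps_below Q $ k) * - (inv_fps_below Q $ l) * - (inv_fps_below Q $ m))"
      by (intro pcong_mult inv_fps_below_refl) (use int in auto)
    then show "pcong r (inv_fps_below Q $ (Q - i) * inv_fps_below Q $ (Q - j) * inv_fps_below Q $ (Q - k) * inv_fps_below Q $ (Q - l) * inv_fps_below Q $ (Q - m))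
      (- (inv_fps_below Q $ i * inv_fps_below Q $ j * inv_fps_below Q $ k * inv_fps_below Q $ l * inv_fps_below Q $ m))"
      by simp
  qed
  then show ?thesis by (simp add: pcong_def add.commute)
qed

text \<open>The first-order term of \<open>1 / (y + i Q)\<close> in \<open>Q\<close> is
  \<open>- i Q / y^2\<close>; this polynomial supplies the inverse squares.\<close>

definition inv_square_fps_below :: "rat fps" where
  "inv_square_fps_below = Abs_fps (\<lambda>n. if p dvd n \<or> Q \<le> n then 0 else 1 / of_nat n ^ 2)"

lemma inv_fps_below_product_integral: "inv_fps_below Q ^ 4 * inv_square_fps_below \<in> integral_fps"
proof -
  have "inv_square_fps_below \<in> integral_fps"
    using pint_divide_nat[OF pint_divide_nat, of 1]
    by (auto simp: inv_square_fps_below_def integral_fps_def power2_eq_square)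
  then show ?thesis by (intro integral_fps_intros inv_fps_below_integral)
qed

lemma fps_supported_inv_fps_below: "fps_supported (inv_fps_below Q) 1 (Q - 1)" "fps_supported inv_square_fps_below 1 (Q - 1)"
  by (auto simp: fps_supported_def inv_fps_below_def inv_square_fps_below_def Suc_le_eq intro!: gr0I split: if_splits)

text \<open>A degree \<open>a Q\<close> that is positive and at most \<open>5 (Q - 1) < 5 Q\<close>
  forces \<open>a\<close> to lie between 1 and 4.\<close>

lemma fps_supported_multiple:
  assumes "fps_supported A 5 (5 * (Q - 1))" "a \<notin> {1..4}"
  shows "A $ (a * Q) = 0"
proof (rule ccontr)
  assume "A $ (a * Q) \<noteq> 0"
  then have "5 \<le> a * Q" "a * Q \<le> 5 * (Q - 1)" using assms(1) by (auto simp: fps_supported_def)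
  moreover have "5 * (Q - 1) < 5 * Q" using Q_pos by simp
  ultimately have "a * Q < 5 * Q" "0 < a * Q" by linarith+
  then show False using assms(2) by auto
qed

text \<open>Write \<open>l = y + i Q\<close> with \<open>y < Q\<close> and expand \<open>1 / l\<close> to second order in \<open>Q\<close>.\<close>

lemma comp_sum_expand:
  "\<exists>R\<in>p_integral p. comp_sum (N * Q) =
     (\<Sum>a\<le>N. comp_sum_below Q a * of_nat (N - a + 4 choose 4))
     - 5 * of_nat Q * (\<Sum>a<N. (inv_fps_below Q ^ 4 * inv_square_fps_below) $ (a * Q) * of_nat (N - a + 4 choose 5))
     + of_nat Q ^ 2 * R"
proof -
  \<comment> \<open>With \<open>y = n mod Q\<close> and \<open>i = n div Q\<close> these come from
    the exact identity \<open>1 / n = 1 / y - Q i / y^2 + Q^2 i^2 / (y^2 n)\<close>;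
    \<open>E'\<close> is \<open>E\<close> without the factor \<open>i\<close>.\<close>
  define D where "D = Abs_fps (\<lambda>n. if p dvd n then 0 else 1 / of_nat (n mod Q) :: rat)"
  define E where "E = Abs_fps (\<lambda>n. if p dvd n then 0 else of_nat (n div Q) / of_nat (n mod Q) ^ 2 :: rat)"
  define E' where "E' = Abs_fps (\<lambda>n. if p dvd n then 0 else 1 / of_nat (n mod Q) ^ 2 :: rat)"
  define R where "R = Abs_fps (\<lambda>n. if p dvd n then 0
      else of_nat (n div Q) ^ 2 / of_nat (n mod Q) ^ 2 / of_nat n :: rat)"
  define q :: "rat fps" where "q = of_nat Q"
  have div_pow: "x / of_nat (n mod Q) ^ 2 \<in> p_integral p" if "\<not> p dvd n" "x \<in> p_integral p" for n x
    using pint_divide_nat[OF pint_divide_nat, of x "n mod Q" "n mod Q"] that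
    by (simp add: p_dvd_mod_Q power2_eq_square)
  have int: "D \<in> integral_fps" "E \<in> integral_fps" "R \<in> integral_fps"
    unfolding D_def E_def R_def integral_fps_def
    by (auto intro!: pint_divide_nat div_pow simp: p_dvd_mod_Q simp del: divide_divide_eq_left)
  have inv_fps: "inv_fps = D + q * (- E + q * R)"
  proof (rule fps_ext)
    fix n
    define y i :: rat where "y = of_nat (n mod Q)" and "i = of_nat (n div Q)"
    have n: "(of_nat n :: rat) = y + i * of_nat Q"
      unfolding y_def i_def by (metis mult.commute mod_mult_div_eq of_nat_add of_nat_mult)
    have "1 / of_nat n = 1 / y + of_nat Q * (- (i / y ^ 2) + of_nat Q * (i ^ 2 / y ^ 2 / of_nat n))"
      if "\<not> p dvd n"
    proof -
      have "y \<noteq> 0" using that p_dvd_mod_Q[of n] unfolding y_def by (intro notI) simp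
      moreover have "of_nat n \<noteq> (0::rat)" using that by (intro notI) simp
      ultimately have "(1 / y + of_nat Q * (- (i / y ^ 2) + of_nat Q * (i ^ 2 / y ^ 2 / of_nat n))) * of_nat n
          = (y * of_nat n - of_nat Q * i * of_nat n + (of_nat Q * i) ^ 2) / y ^ 2"
        by (simp add: field_simps power2_eq_square)
      also have "y * of_nat n - of_nat Q * i * of_nat n + (of_nat Q * i) ^ 2 = y ^ 2"
        unfolding n by (simp add: algebra_simps power2_eq_square)
      also have "y ^ 2 / y ^ 2 = 1" using \<open>y \<noteq> 0\<close> by simp
      finally show ?thesis using eq_divide_imp[OF \<open>of_nat n \<noteq> (0::rat)\<close>] by metis
    qed
    then show "inv_fps $ n = (D + q * (- E + q * R)) $ n"
      by (simp add: inv_fps_def D_def E_def R_def q_def y_def i_def fps_of_nat[symmetric])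
  qed
  define V where "V = - E + q * R"
  \<comment> \<open>\<open>W\<close> gathers everything in \<open>(D + q V)^5\<close> that carries
    the factor \<open>q^2\<close>, including the part \<open>q R\<close> of \<open>V\<close> in the
    linear term.\<close>
  define W where "W = 5 * D ^ 4 * R + (10 * D ^ 3 * V ^ 2 + 10 * q * D ^ 2 * V ^ 3 + 5 * q ^ 2 * D * V ^ 4 + q ^ 3 * V ^ 5)"
  have "- E \<in> integral_fps" using int(2) by (auto simp: integral_fps_def)
  then have "V \<in> integral_fps" unfolding V_def q_def by (intro integral_fps_intros int)
  then have W: "W \<in> integral_fps"
    unfolding W_def q_def using integral_fps_of_nat[of 5] integral_fps_of_nat[of 10]
    by (intro integral_fps_intros int) auto
  have "inv_fps ^ 5 = D ^ 5 + 5 * q * D ^ 4 * V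
      + q ^ 2 * (10 * D ^ 3 * V ^ 2 + 10 * q * D ^ 2 * V ^ 3 + 5 * q ^ 2 * D * V ^ 4 + q ^ 3 * V ^ 5)"
    unfolding inv_fps V_def[symmetric] by (simp add: algebra_simps eval_nat_numeral)
  also have "5 * q * D ^ 4 * V = - (5 * q * (D ^ 4 * E)) + q ^ 2 * (5 * D ^ 4 * R)"
    by (simp add: V_def algebra_simps power2_eq_square)
  finally have F5: "inv_fps ^ 5 = D ^ 5 - 5 * q * (D ^ 4 * E) + q ^ 2 * W"
    by (simp only: W_def distrib_left diff_conv_add_uminus add.assoc)
  \<comment> \<open>The coefficients of \<open>D\<close> and of \<open>E'\<close> have period
    \<open>Q\<close>, so multiplying by \<open>1 - X^Q\<close> leaves just the first period.\<close>
  have D: "D * (1 - fps_X ^ Q) ^ Suc 0 = inv_fps_below Q"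
    using Q_pos p_dvd_Q
    by (auto simp: fps_eq_iff one_minus_X_power_nth mult.commute D_def inv_fps_below_def le_mod_geq p_dvd_diff_Q)
  have E': "E' * (1 - fps_X ^ Q) ^ Suc 0 = inv_square_fps_below"
    using Q_pos p_dvd_Q
    by (auto simp: fps_eq_iff one_minus_X_power_nth mult.commute E'_def inv_square_fps_below_def le_mod_geq p_dvd_diff_Q)
  \<comment> \<open>The factor \<open>i\<close> grows by one from each period to the next, so the
    difference of \<open>E\<close> is \<open>E'\<close> delayed by \<open>Q\<close>.\<close>
  have E: "E * (1 - fps_X ^ Q) = fps_X ^ Q * E'"
  proof (subst mult.commute, rule fps_ext)
    fix n
    show "((1 - fps_X ^ Q) * E) $ n = (fps_X ^ Q * E') $ n"
    proof (cases "n < Q")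
      case False
      then have "n div Q = Suc ((n - Q) div Q)" "n mod Q = (n - Q) mod Q" "p dvd n - Q \<longleftrightarrow> p dvd n"
        using Q_pos by (simp_all add: le_div_geq le_mod_geq p_dvd_diff_Q)
      then show ?thesis using False
        by (simp add: one_minus_X_power_nth fps_X_power_mult_nth E_def E'_def
            add_divide_distrib)
    qed (simp add: one_minus_X_power_nth fps_X_power_mult_nth E_def)
  qed
  have D5: "D ^ 5 = inv_fps_below Q ^ 5 * geom_fps Q 4"
    by (rule one_minus_fps_X_power_mult_cancel[OF _ Q_pos])
      (simp add: D[symmetric] power_mult_distrib)
  \<comment> \<open>Each factor \<open>D\<close> contributes one denominator \<open>1 - X^Q\<close>
    and \<open>E\<close> contributes two, which makes six.\<close>
  have "D ^ 4 * E * (1 - fps_X ^ Q) ^ Suc 5 = inv_fps_below Q ^ 4 * (E * (1 - fps_X ^ Q)) * (1 - fps_X ^ Q)"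
    unfolding D[symmetric] by (simp add: power_mult_distrib eval_nat_numeral mult_ac)
  also have "\<dots> = fps_X ^ Q * (inv_fps_below Q ^ 4 * inv_square_fps_below)"
    unfolding E E'[symmetric] by (simp add: mult_ac)
  finally have DE: "D ^ 4 * E = fps_X ^ Q * (inv_fps_below Q ^ 4 * inv_square_fps_below) * geom_fps Q 5"
    by (rule one_minus_fps_X_power_mult_cancel[OF _ Q_pos])
  have "(D ^ 4 * E) $ (N * Q) = (\<Sum>a\<le>N. (fps_X ^ Q * (inv_fps_below Q ^ 4 * inv_square_fps_below)) $ (a * Q) * of_nat (N - a + 5 choose 5))"
    unfolding DE by (rule mult_geom_fps_nth[OF Q_pos])
  \<comment> \<open>The factor \<open>X^Q\<close> kills \<open>a = 0\<close> and shifts the other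
    indices by one, so that \<open>N - (a + 1) + 5\<close> becomes \<open>N - a + 4\<close>.\<close>
  also have "\<dots> = (\<Sum>a\<in>Suc ` {..<N}. (fps_X ^ Q * (inv_fps_below Q ^ 4 * inv_square_fps_below)) $ (a * Q) * of_nat (N - a + 5 choose 5))"
  proof (rule sum.mono_neutral_right)
    show "\<forall>a\<in>{..N} - Suc ` {..<N}. (fps_X ^ Q * (inv_fps_below Q ^ 4 * inv_square_fps_below)) $ (a * Q) * of_nat (N - a + 5 choose 5) = 0"
      using Q_pos by (auto simp: image_Suc_lessThan fps_X_power_mult_nth)
  qed auto
  also have "\<dots> = (\<Sum>a<N. (inv_fps_below Q ^ 4 * inv_square_fps_below) $ (a * Q) * of_nat (N - a + 4 choose 5))"
  proof (subst sum.reindex, simp, rule sum.cong, goal_cases)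
    case (2 a)
    then have "N - Suc a + 5 = N - a + 4" by simp
    then show ?case by (simp only: o_apply fps_X_power_mult_nth) simp
  qed simp
  finally have E_sum: "(D ^ 4 * E) $ (N * Q) = (\<Sum>a<N. (inv_fps_below Q ^ 4 * inv_square_fps_below) $ (a * Q) * of_nat (N - a + 4 choose 5))" .
  have D_sum: "D ^ 5 $ (N * Q) = (\<Sum>a\<le>N. comp_sum_below Q a * of_nat (N - a + 4 choose 4))"
    unfolding D5 mult_geom_fps_nth[OF Q_pos] comp_sum_below_def ..
  have q: "q = fps_const (of_nat Q)" "5 * q = fps_const (5 * of_nat Q)"
    unfolding q_def by (simp_all add: fps_of_nat[symmetric] numeral_fps_const)
  have "comp_sum (N * Q) = D ^ 5 $ (N * Q) - 5 * of_nat Q * (D ^ 4 * E) $ (N * Q) + of_nat Q ^ 2 * W $ (N * Q)"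
    unfolding comp_sum_def F5 q(2) by (simp add: q(1) fps_const_power mult.assoc)
  moreover have "W $ (N * Q) \<in> p_integral p" using W by (simp add: integral_fps_def)
  ultimately show ?thesis unfolding E_sum D_sum by blast
qed

end

end

section \<open>Lifting for primes above 5, where \<open>4!\<close> and \<open>5!\<close> are
  units\<close>

locale padic_gt_5 = padic +
  assumes p_gt_5: "p > 5"
begin

lemma p_ndvd_2: "\<not> p dvd 2" and p_ndvd_3: "\<not> p dvd 3" and p_ndvd_5: "\<not> p dvd 5"
  using p_gt_5 by (auto dest: dvd_imp_le)

lemma p_ndvd_mult: "\<not> p dvd a \<Longrightarrow> \<not> p dvd b \<Longrightarrow> \<not> p dvd a * b"
  using prime_p by (simp add: prime_dvd_mult_iff)

lemma p_ndvd: "\<not> p dvd 4" "\<not> p dvd 6" "\<not> p dvd 12" "\<not> p dvd 24" "\<not> p dvd 120"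
  using p_ndvd_mult[OF p_ndvd_2 p_ndvd_2] p_ndvd_mult[OF p_ndvd_2 p_ndvd_3]
    p_ndvd_mult[OF p_ndvd_2 p_ndvd_mult[OF p_ndvd_2 p_ndvd_3]]
    p_ndvd_mult[OF p_ndvd_2 p_ndvd_mult[OF p_ndvd_2 p_ndvd_mult[OF p_ndvd_2 p_ndvd_3]]]
    p_ndvd_mult[OF p_ndvd_5 p_ndvd_mult[OF p_ndvd_2 p_ndvd_mult[OF p_ndvd_2 p_ndvd_mult[OF p_ndvd_2 p_ndvd_3]]]]
  by simp_all

lemma pint_divide_numeral:
  assumes "x \<in> p_integral p"
  shows "x / 2 \<in> p_integral p" "x / 3 \<in> p_integral p" "x / 4 \<in> p_integral p" "x / 5 \<in> p_integral p"
    "x / 6 \<in> p_integral p" "x / 12 \<in> p_integral p" "x / 24 \<in> p_integral p" "x / 120 \<in> p_integral p"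
  using pint_divide_nat[OF assms p_ndvd_2] pint_divide_nat[OF assms p_ndvd_3] pint_divide_nat[OF assms p_ndvd_5]
    p_ndvd[THEN pint_divide_nat[OF assms]] by simp_all

lemma choose_4_rat: "of_nat (n choose 4) = (of_nat n * (of_nat n - 1) * (of_nat n - 2) * (of_nat n - 3) / 24 :: rat)"
  by (simp add: binomial_gbinomial gbinomial_prod_rev numeral_eq_Suc fact_numeral)

lemma choose_5_rat:
  "of_nat (n choose 5) = (of_nat n * (of_nat n - 1) * (of_nat n - 2) * (of_nat n - 3) * (of_nat n - 4) / 120 :: rat)"
  by (simp add: binomial_gbinomial gbinomial_prod_rev numeral_eq_Suc fact_numeral)

text \<open>For these shifts \<open>N\<close> is one of the four factors in the numerator. The
  right-hand sides are the linear terms of the resulting quartics in \<open>N\<close>; what remains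
  is divisible by \<open>N^2\<close>.\<close>

lemma choose_4_cong:
  assumes "p dvd N" "N > 0"
  shows "pcong 2 (of_nat (N - 1 + 4 choose 4)) (of_nat N / 4)"
    "pcong 2 (of_nat (N - 2 + 4 choose 4)) (- of_nat N / 12)"
    "pcong 2 (of_nat (N - 3 + 4 choose 4)) (of_nat N / 12)"
    "pcong 2 (of_nat (N - 4 + 4 choose 4)) (- of_nat N / 4)"
proof -
  obtain m where m: "N = p * m" using assms by blast
  have N: "N > 5" using assms p_gt_5 by (auto dest!: dvd_imp_le)
  define x :: rat where "x = of_nat N"
  have x: "c * x ^ 2 \<in> pideal 2" if "c \<in> p_integral p" for c
    using pidealI[of "c * of_nat m ^ 2" 2] that by (auto simp: x_def m power_mult_distrib mult_ac)
  have int: "x \<in> p_integral p" by (auto simp: x_def)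
  have N': "of_nat (N - 1 + 4) = x + 3" "of_nat (N - 2 + 4) = x + 2" "of_nat (N - 3 + 4) = x + 1"
    "of_nat (N - 4 + 4) = x"
    using N by (simp_all add: x_def of_nat_diff)
  have "(x + 3) * (x + 3 - 1) * (x + 3 - 2) * (x + 3 - 3) / 24 - x / 4 = ((x ^ 2 + 6 * x + 11) / 24) * x ^ 2"
    by (simp add: field_simps power2_eq_square)
  also have "\<dots> \<in> pideal 2" by (intro x pints pint_divide_numeral int)
  finally show "pcong 2 (of_nat (N - 1 + 4 choose 4)) (of_nat N / 4)"
    unfolding pcong_def choose_4_rat N' x_def[symmetric] .
  have "(x + 2) * (x + 2 - 1) * (x + 2 - 2) * (x + 2 - 3) / 24 - - x / 12 = ((x ^ 2 + 2 * x - 1) / 24) * x ^ 2"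
    by (simp add: field_simps power2_eq_square)
  also have "\<dots> \<in> pideal 2" by (intro x pints pint_divide_numeral int)
  finally show "pcong 2 (of_nat (N - 2 + 4 choose 4)) (- of_nat N / 12)"
    unfolding pcong_def choose_4_rat N' x_def[symmetric] .
  have "(x + 1) * (x + 1 - 1) * (x + 1 - 2) * (x + 1 - 3) / 24 - x / 12 = ((x ^ 2 - 2 * x - 1) / 24) * x ^ 2"
    by (simp add: field_simps power2_eq_square)
  also have "\<dots> \<in> pideal 2" by (intro x pints pint_divide_numeral int)
  finally show "pcong 2 (of_nat (N - 3 + 4 choose 4)) (of_nat N / 12)"
    unfolding pcong_def choose_4_rat N' x_def[symmetric] .
  have "x * (x - 1) * (x - 2) * (x - 3) / 24 - - x / 4 = ((x ^ 2 - 6 * x + 11) / 24) * x ^ 2"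
    by (simp add: field_simps power2_eq_square)
  also have "\<dots> \<in> pideal 2" by (intro x pints pint_divide_numeral int)
  finally show "pcong 2 (of_nat (N - 4 + 4 choose 4)) (- of_nat N / 4)"
    unfolding pcong_def choose_4_rat N' x_def[symmetric] .
qed

text \<open>\<open>N\<close> is among the five consecutive factors
  \<open>N - a + 4, ..., N - a\<close>, and 120 is a unit. Together with the factor \<open>Q\<close>
  this removes the first-order term of \<open>comp_sum_expand\<close> modulo
  \<open>p Q\<close>.\<close>

lemma choose_5_pideal:
  assumes "p dvd N" "N > 0" "a \<in> {1..4}"
  shows "of_nat (N - a + 4 choose 5) \<in> pideal 1"
proof -
  obtain m where m: "N = p * m" using assms by blast
  have N: "N > 5" using assms p_gt_5 by (auto dest!: dvd_imp_le)
  define x :: rat where "x = of_nat N"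
  have x: "c * x \<in> pideal 1" if "c \<in> p_integral p" for c
    using pidealI[of "c * of_nat m" 1] that by (auto simp: x_def m mult_ac)
  have int: "x \<in> p_integral p" by (auto simp: x_def)
  have N': "of_nat (N - 1 + 4) = x + 3" "of_nat (N - 2 + 4) = x + 2" "of_nat (N - 3 + 4) = x + 1"
    "of_nat (N - 4 + 4) = x"
    using N by (simp_all add: x_def of_nat_diff)
  have "of_nat (N - 1 + 4 choose 5) = (x + 3) * (x + 2) * (x + 1) * (x - 1) / 120 * x"
    unfolding choose_5_rat N' by (simp add: add.commute)
  moreover have "of_nat (N - 2 + 4 choose 5) = (x + 2) * (x + 1) * (x - 1) * (x - 2) / 120 * x"
    unfolding choose_5_rat N' by (simp add: add.commute)
  moreover have "of_nat (N - 3 + 4 choose 5) = (x + 1) * (x - 1) * (x - 2) * (x - 3) / 120 * x"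
    unfolding choose_5_rat N' by (simp add: add.commute)
  moreover have "of_nat (N - 4 + 4 choose 5) = (x - 1) * (x - 2) * (x - 3) * (x - 4) / 120 * x"
    unfolding choose_5_rat N' by (simp add: add.commute)
  ultimately have "of_nat (N - b + 4 choose 5) \<in> pideal 1" if "b = 1 \<or> b = 2 \<or> b = 3 \<or> b = 4" for b
    using that by (elim disjE; simp only:; intro x pints pint_divide_numeral int)
  moreover have "a = 1 \<or> a = 2 \<or> a = 3 \<or> a = 4" using assms by auto
  ultimately show ?thesis by blast
qed

context
  fixes r Q :: nat
  assumes r: "r \<ge> 1" and Q: "Q = p ^ r"
begin

lemma comp_sum_below_eq_0: "a \<notin> {1..4} \<Longrightarrow> comp_sum_below Q a = 0"
  unfolding comp_sum_below_def
  by (rule fps_supported_multiple[OF r Q])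
    (use fps_supported_power[OF fps_supported_inv_fps_below(1)[OF r Q], of 5] in simp_all)

text \<open>\<open>comp_sum_expand\<close> at \<open>N = 1\<close> and \<open>N = 2\<close>, where
  \<open>S 0 = 0\<close>; the coefficient 5 is \<open>5 choose 4\<close>.\<close>

lemma comp_sum_cong_mod_Q:
  shows "pcong r (comp_sum Q) (comp_sum_below Q 1)" "pcong r (comp_sum (2 * Q)) (comp_sum_below Q 2 + 5 * comp_sum_below Q 1)"
proof -
  have *: "pcong r (comp_sum (N * Q)) (\<Sum>a\<le>N. comp_sum_below Q a * of_nat (N - a + 4 choose 4))" for N
  proof -
    define T where "T = (\<Sum>a<N. (inv_fps_below Q ^ 4 * inv_square_fps_below Q) $ (a * Q) * of_nat (N - a + 4 choose 5))"
    have "T \<in> p_integral p"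
      using inv_fps_below_product_integral[OF r Q] unfolding T_def integral_fps_def by auto
    moreover obtain R where R: "R \<in> p_integral p" "comp_sum (N * Q) =
     (\<Sum>a\<le>N. comp_sum_below Q a * of_nat (N - a + 4 choose 4)) - 5 * of_nat Q * T + of_nat Q ^ 2 * R"
      using comp_sum_expand[OF r Q, of N] T_def by blast
    moreover have "of_nat Q * (- 5 * T + of_nat Q * R) \<in> pideal r"
      using calculation by (intro pideal_mult_integral Q_pideal[OF r Q]) auto
    moreover have "comp_sum (N * Q) - (\<Sum>a\<le>N. comp_sum_below Q a * of_nat (N - a + 4 choose 4)) = of_nat Q * (- 5 * T + of_nat Q * R)"
      unfolding R(2) by (simp add: algebra_simps power2_eq_square)
    ultimately show ?thesis by (simp only: pcong_def)
  qed
  show "pcong r (comp_sum Q) (comp_sum_below Q 1)"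
    using *[of 1] by (simp add: comp_sum_below_eq_0)
  show "pcong r (comp_sum (2 * Q)) (comp_sum_below Q 2 + 5 * comp_sum_below Q 1)"
    using *[of 2] by (simp add: comp_sum_below_eq_0 numeral_2_eq_2 atMost_Suc mult.commute binomial_eq_0 eval_nat_numeral)
qed

text \<open>Write \<open>x = m p\<close>. With \<open>S 3 = - S 2\<close> and
  \<open>S 4 = - S 1\<close> modulo \<open>Q\<close>, the binomial weights give
  \<open>x (S 1 / 2 - S 2 / 6)\<close>. Substituting \<open>S 1 = U Q\<close> and
  \<open>S 2 = U (2 Q) - 5 U Q\<close> yields the coefficients \<open>4/3\<close> and
  \<open>- 1/6\<close>.\<close>

lemma comp_sum_lift:
  assumes "comp_sum Q \<in> pideal (r - 1)" "comp_sum (2 * Q) \<in> pideal (r - 1)" "m > 0"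
  shows "pcong (Suc r) (comp_sum (m * p * Q)) (of_nat (m * p) * (4 / 3 * comp_sum Q - comp_sum (2 * Q) / 6))"
proof -
  define N where "N = m * p"
  define x :: rat where "x = of_nat N"
  have N: "p dvd N" "N > 0" using assms p_pos by (auto simp: N_def)
  have "N > 5" using N p_gt_5 by (auto dest!: dvd_imp_le)
  have x: "c * x \<in> pideal (Suc k)" if "c \<in> pideal k" for c k
    using pideal_mult[OF that, of x 1] pideal_mult_integral(1)[OF p_pideal(1), of "of_nat m"]
    by (auto simp: x_def N_def)
  have r1: "pideal r \<subseteq> pideal (r - 1)" using pideal_mono by auto
  have S12: "comp_sum_below Q 1 \<in> pideal (r - 1)" "comp_sum_below Q 2 \<in> pideal (r - 1)"
  proof -
    show S1: "comp_sum_below Q 1 \<in> pideal (r - 1)"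
      using comp_sum_cong_mod_Q(1) assms(1) pideal_diff[of "comp_sum Q" "r - 1" "comp_sum Q - comp_sum_below Q 1"] r1 by (auto simp: pcong_def)
    show "comp_sum_below Q 2 \<in> pideal (r - 1)"
      using comp_sum_cong_mod_Q(2) assms(2) r1 pideal_mult_integral(1)[OF S1, of 5]
        pideal_diff[of "comp_sum (2 * Q)" "r - 1" "comp_sum (2 * Q) - (comp_sum_below Q 2 + 5 * comp_sum_below Q 1)"]
        pideal_diff[of "comp_sum_below Q 2 + 5 * comp_sum_below Q 1" "r - 1" "5 * comp_sum_below Q 1"]
      by (auto simp: pcong_def)
  qed
  have refl: "comp_sum_below Q 1 + comp_sum_below Q 4 \<in> pideal r" "comp_sum_below Q 2 + comp_sum_below Q 3 \<in> pideal r"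
    using comp_sum_below_reflect[OF r Q, of 1] comp_sum_below_reflect[OF r Q, of 2] by simp_all
  have S34: "comp_sum_below Q 4 \<in> pideal (r - 1)" "comp_sum_below Q 3 \<in> pideal (r - 1)"
    using pideal_diff[of "comp_sum_below Q 1 + comp_sum_below Q 4" "r - 1" "comp_sum_below Q 1"] pideal_diff[of "comp_sum_below Q 2 + comp_sum_below Q 3" "r - 1" "comp_sum_below Q 2"] refl S12 r1
    by auto
  \<comment> \<open>The weights are known modulo \<open>p^2\<close> only; the factor
    \<open>p^(r-1)\<close> of \<open>S a\<close> raises the precision to \<open>p^(r+1)\<close>.
    This is what the divisibility hypotheses are for.\<close>
  have prod: "pcong (Suc r) (comp_sum_below Q a * b) (comp_sum_below Q a * c)" if "comp_sum_below Q a \<in> pideal (r - 1)" "pcong 2 b c" for a b c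
    using pideal_mult[of "comp_sum_below Q a" "r - 1" "b - c" 2] that r by (simp add: pcong_def algebra_simps)
  have sum_1234: "(\<Sum>a\<in>{1, 2, 3, 4}. h a) = h 1 + (h 2 + (h 3 + h 4))" for h :: "nat \<Rightarrow> rat"
    by simp
  have "(\<Sum>a\<le>N. comp_sum_below Q a * of_nat (N - a + 4 choose 4)) = (\<Sum>a\<in>{1,2,3,4}. comp_sum_below Q a * of_nat (N - a + 4 choose 4))"
  proof (rule sum.mono_neutral_right)
    show "\<forall>a\<in>{..N} - {1,2,3,4}. comp_sum_below Q a * of_nat (N - a + 4 choose 4) = 0"
    proof
      fix a assume "a \<in> {..N} - {1,2,3,4}"
      then have "a \<notin> {1..4}" by auto
      then show "comp_sum_below Q a * of_nat (N - a + 4 choose 4) = 0" by (simp add: comp_sum_below_eq_0)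
    qed
  qed (use \<open>N > 5\<close> in auto)
  also have "\<dots> = comp_sum_below Q 1 * of_nat (N - 1 + 4 choose 4) + (comp_sum_below Q 2 * of_nat (N - 2 + 4 choose 4)
      + (comp_sum_below Q 3 * of_nat (N - 3 + 4 choose 4) + comp_sum_below Q 4 * of_nat (N - 4 + 4 choose 4)))"
    by (rule sum_1234)
  also have "pcong (Suc r) \<dots> (comp_sum_below Q 1 * (x / 4) + (comp_sum_below Q 2 * (- x / 12) + (comp_sum_below Q 3 * (x / 12) + comp_sum_below Q 4 * (- x / 4))))"
    unfolding x_def using choose_4_cong[OF N] S12 S34 by (intro pcong_add prod)
  also have "pcong (Suc r) \<dots> (x * (4 / 3 * comp_sum Q - comp_sum (2 * Q) / 6))"
  proof -
    \<comment> \<open>The difference is a combination of four errors divisible by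
      \<open>p^r\<close>, and \<open>x\<close> supplies one more factor \<open>p\<close>.\<close>
    have "comp_sum_below Q 1 * (x / 4) + (comp_sum_below Q 2 * (- x / 12) + (comp_sum_below Q 3 * (x / 12) + comp_sum_below Q 4 * (- x / 4)))
        - x * (4 / 3 * comp_sum Q - comp_sum (2 * Q) / 6)
      = ((comp_sum_below Q 2 + comp_sum_below Q 3) / 12 - (comp_sum_below Q 1 + comp_sum_below Q 4) / 4 - 4 * (comp_sum Q - comp_sum_below Q 1) / 3
        + (comp_sum (2 * Q) - (comp_sum_below Q 2 + 5 * comp_sum_below Q 1)) / 6) * x"
      by (simp add: field_simps)
    also have "\<dots> \<in> pideal (Suc r)"
    proof (intro x pideal_add pideal_diff)
      have div: "a / of_nat n \<in> pideal r" if "a \<in> pideal r" "\<not> p dvd n" for a n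
        using that pideal_divide_nat by blast
      show "(comp_sum_below Q 2 + comp_sum_below Q 3) / 12 \<in> pideal r" using div[OF refl(2) p_ndvd(3)] by simp
      show "(comp_sum_below Q 1 + comp_sum_below Q 4) / 4 \<in> pideal r" using div[OF refl(1) p_ndvd(1)] by simp
      show "4 * (comp_sum Q - comp_sum_below Q 1) / 3 \<in> pideal r"
        using div[OF pideal_mult_integral(1)[of "comp_sum Q - comp_sum_below Q 1" r 4] p_ndvd_3] comp_sum_cong_mod_Q(1) by (simp add: pcong_def)
      show "(comp_sum (2 * Q) - (comp_sum_below Q 2 + 5 * comp_sum_below Q 1)) / 6 \<in> pideal r"
        using div[OF comp_sum_cong_mod_Q(2)[unfolded pcong_def] p_ndvd(2)] by simp
    qed
    finally show ?thesis by (simp add: pcong_def)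
  qed
  finally have main: "pcong (Suc r) (\<Sum>a\<le>N. comp_sum_below Q a * of_nat (N - a + 4 choose 4)) (x * (4 / 3 * comp_sum Q - comp_sum (2 * Q) / 6))" .
  define T where "T = (\<Sum>a<N. (inv_fps_below Q ^ 4 * inv_square_fps_below Q) $ (a * Q) * of_nat (N - a + 4 choose 5))"
  have T: "T \<in> pideal 1" unfolding T_def
  proof (rule pideal_sum)
    fix a
    show "(inv_fps_below Q ^ 4 * inv_square_fps_below Q) $ (a * Q) * of_nat (N - a + 4 choose 5) \<in> pideal 1"
    proof (cases "a \<in> {1..4}")
      case True
      then show ?thesis using inv_fps_below_product_integral[OF r Q] choose_5_pideal[OF N] by (intro pideal_mult_integral) (auto simp: integral_fps_def)
    next
      case False
      have "fps_supported (inv_fps_below Q ^ 4 * inv_square_fps_below Q) (4 * 1 + 1) (4 * (Q - 1) + (Q - 1))"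
        by (intro fps_supported_mult fps_supported_power fps_supported_inv_fps_below[OF r Q])
      then have "fps_supported (inv_fps_below Q ^ 4 * inv_square_fps_below Q) 5 (5 * (Q - 1))" by simp
      from fps_supported_multiple[OF r Q this False] show ?thesis by simp
    qed
  qed
  obtain R where R: "R \<in> p_integral p" "comp_sum (N * Q) =
     (\<Sum>a\<le>N. comp_sum_below Q a * of_nat (N - a + 4 choose 4)) - 5 * of_nat Q * T + of_nat Q ^ 2 * R"
    using comp_sum_expand[OF r Q, of N] T_def by blast
  have "- (5 * (of_nat Q * T)) + of_nat Q ^ 2 * R \<in> pideal (Suc r)"
  proof (intro pideal_add pideal_uminus)
    show "5 * (of_nat Q * T) \<in> pideal (Suc r)"
      using pideal_mult_integral(1)[OF pideal_mult[OF Q_pideal[OF r Q] T], of 5] by simp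
    \<comment> \<open>From \<open>r >= 1\<close> follows \<open>2 r >= r + 1\<close>.\<close>
    have "of_nat Q ^ 2 \<in> pideal (r + r)"
      unfolding power2_eq_square by (intro pideal_mult Q_pideal[OF r Q])
    then show "of_nat Q ^ 2 * R \<in> pideal (Suc r)"
      using pideal_mono[OF pideal_mult_integral(2)[OF _ R(1)], of "of_nat Q ^ 2" "r + r" "Suc r"] r by simp
  qed
  then have "pcong (Suc r) (comp_sum (N * Q)) (\<Sum>a\<le>N. comp_sum_below Q a * of_nat (N - a + 4 choose 4))"
    unfolding R(2) by (simp add: pcong_def algebra_simps)
  from pcong_trans[OF this main] show ?thesis by (simp add: N_def x_def)
qed

end

text \<open>Passing from \<open>p\<close> to \<open>p^2\<close> gives
  \<open>4/3 - 3/6 = 5/6\<close>; in every later step the factor is \<open>4/3 - 2/6 = 1\<close>.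
  The factor \<open>m\<close> stays general because the induction step needs the cases 1 and
  2.\<close>

lemma comp_sum_prime_power:
  assumes base: "pcong 1 (comp_sum (2 * p)) (3 * comp_sum p)" and "r \<ge> 2" "m > 0"
  shows "pcong r (comp_sum (m * p ^ r)) (of_nat m * of_nat p ^ (r - 1) * (5 / 6 * comp_sum p))"
  using \<open>r \<ge> 2\<close> \<open>m > 0\<close>
proof (induction r arbitrary: m rule: dec_induct)
  case base
  have "pcong 2 (comp_sum (m * p * p)) (of_nat (m * p) * (4 / 3 * comp_sum p - comp_sum (2 * p) / 6))"
    \<comment> \<open>At \<open>Q = p\<close> the divisibility hypotheses of the lift reduce to
      integrality.\<close>
    using comp_sum_lift[of 1 p m] base comp_sum_integral by (simp add: pideal_0 numeral_2_eq_2)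
  also have "pcong 2 \<dots> (of_nat m * of_nat p * (5 / 6 * comp_sum p))"
  proof -
    have "of_nat (m * p) * (4 / 3 * comp_sum p - comp_sum (2 * p) / 6) - of_nat m * of_nat p * (5 / 6 * comp_sum p)
      = of_nat p * (of_nat m * (- (comp_sum (2 * p) - 3 * comp_sum p) / 6))" by (simp add: field_simps)
    also have "- (comp_sum (2 * p) - 3 * comp_sum p) / 6 \<in> pideal 1"
      using pideal_divide_nat[OF pideal_uminus[OF assms(1)[unfolded pcong_def]] p_ndvd(2)] by simp
    then have "of_nat p * (of_nat m * (- (comp_sum (2 * p) - 3 * comp_sum p) / 6)) \<in> pideal (1 + 1)"
      by (intro pideal_mult pideal_mult_integral(1)) auto
    finally show ?thesis by (simp add: pcong_def numeral_2_eq_2)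
  qed
  finally show ?case by (simp add: power2_eq_square mult.assoc)
next
  case (step r)
  define v where "v = of_nat p ^ (r - 1) * (5 / 6 * comp_sum p)"
  have "5 / 6 * comp_sum p \<in> p_integral p"
    by (intro pints pint_divide_numeral comp_sum_integral)
  then have v: "v \<in> pideal (r - 1)" unfolding v_def by (rule pidealI)
  have 1: "pcong r (comp_sum (p ^ r)) v" and 2: "pcong r (comp_sum (2 * p ^ r)) (2 * v)"
    using step.IH[of 1] step.IH[of 2] by (simp_all add: v_def mult.assoc)
  have int: "comp_sum (p ^ r) \<in> pideal (r - 1)" "comp_sum (2 * p ^ r) \<in> pideal (r - 1)"
    using pideal_add[OF v pideal_mono[OF 1[unfolded pcong_def], of "r - 1"]]
      pideal_add[OF pideal_mult_integral(1)[OF v, of 2] pideal_mono[OF 2[unfolded pcong_def], of "r - 1"]] by auto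
  have "pcong (Suc r) (comp_sum (m * p * p ^ r)) (of_nat (m * p) * (4 / 3 * comp_sum (p ^ r) - comp_sum (2 * p ^ r) / 6))"
    using comp_sum_lift[of r "p ^ r" m] int step by simp
  also have "pcong (Suc r) \<dots> (of_nat m * of_nat p * v)"
  proof -
    have "of_nat (m * p) * (4 / 3 * comp_sum (p ^ r) - comp_sum (2 * p ^ r) / 6) - of_nat m * of_nat p * v
      = of_nat p * (of_nat m * (4 * (comp_sum (p ^ r) - v) / 3 - (comp_sum (2 * p ^ r) - 2 * v) / 6))"
      by (simp add: field_simps)
    also have "4 * (comp_sum (p ^ r) - v) / 3 - (comp_sum (2 * p ^ r) - 2 * v) / 6 \<in> pideal r"
      using pideal_divide_nat[OF pideal_mult_integral(1)[OF 1[unfolded pcong_def], of 4] p_ndvd_3]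
        pideal_divide_nat[OF 2[unfolded pcong_def] p_ndvd(2)] by auto
    then have "of_nat p * (of_nat m * (4 * (comp_sum (p ^ r) - v) / 3 - (comp_sum (2 * p ^ r) - 2 * v) / 6)) \<in> pideal (1 + r)"
      by (intro pideal_mult pideal_mult_integral(1)) auto
    finally show ?thesis by (simp add: pcong_def)
  qed
  finally show ?case using step(1) by (cases r) (simp_all add: v_def mult_ac)
qed

end

section \<open>Elementary symmetric functions and Bernoulli numbers\<close>

text \<open>The elementary symmetric polynomial of degree \<open>k\<close> in
  \<open>x 0, ..., x (N - 1)\<close>, split according to whether the last variable occurs.\<close>

fun esym :: "(nat \<Rightarrow> rat) \<Rightarrow> nat \<Rightarrow> nat \<Rightarrow> rat" where
  "esym x 0 N = 1"
| "esym x (Suc k) 0 = 0"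
| "esym x (Suc k) (Suc N) = esym x (Suc k) N + x N * esym x k N"

lemma esym_Suc_eq_sum: "esym x (Suc k) N = (\<Sum>M<N. x M * esym x k M)"
  by (induction N) auto

lemma esym_cong: "(\<And>j. j < N \<Longrightarrow> x j = y j) \<Longrightarrow> esym x k N = esym y k N"
  by (induction x k N rule: esym.induct) auto

text \<open>Elementary symmetric polynomials have degree one in each variable, and \<open>y\<close>
  is \<open>x\<close> with variable \<open>c\<close> set to 0. Later this isolates the term
  \<open>1 / p\<close>.\<close>

lemma esym_change_one:
  assumes "y c = 0" "\<And>j. j \<noteq> c \<Longrightarrow> x j = y j" "c < N"
  shows "esym x (Suc k) N = esym y (Suc k) N + x c * esym y k N"
  using \<open>c < N\<close>
proof (induction N arbitrary: k)
  case (Suc N)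
  show ?case
  proof (cases "N = c")
    case True
    have "esym x l c = esym y l c" for l
      using assms(2) by (intro esym_cong) auto
    moreover have "esym y l (Suc c) = esym y l c" for l
      using assms(1) by (cases l) auto
    ultimately show ?thesis using True assms(1) by simp
  next
    case False
    then have "esym x (Suc l) N = esym y (Suc l) N + x c * esym y l N" for l
      using Suc.prems by (intro Suc.IH) simp
    then show ?thesis using False assms(2) by (cases k) (simp_all add: algebra_simps)
  qed
qed simp

text \<open>Newton's identities in closed form. In each degree the induction adds one variable and
  uses the identity of the preceding degree.\<close>

lemma esym_newton:
  fixes x N
  defines "s \<equiv> \<lambda>k. \<Sum>j<N. x j ^ k"
  shows "esym x (Suc 0) N = s 1"
    and "2 * esym x 2 N = s 1 ^ 2 - s 2"
    and "6 * esym x 3 N = s 1 ^ 3 - 3 * s 1 * s 2 + 2 * s 3"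
    and "24 * esym x 4 N = s 1 ^ 4 - 6 * s 1 ^ 2 * s 2 + 3 * s 2 ^ 2 + 8 * s 1 * s 3 - 6 * s 4"
proof -
  have 1: "esym x (Suc 0) N = (\<Sum>j<N. x j)" for N
    by (induction N) auto
  have 2: "2 * esym x 2 N = (\<Sum>j<N. x j) ^ 2 - (\<Sum>j<N. x j ^ 2)" for N
    by (induction N) (simp_all add: numeral_2_eq_2 1 algebra_simps)
  have 3: "6 * esym x 3 N = (\<Sum>j<N. x j) ^ 3 - 3 * (\<Sum>j<N. x j) * (\<Sum>j<N. x j ^ 2) + 2 * (\<Sum>j<N. x j ^ 3)" for N
  proof (induction N)
    case (Suc N)
    have "6 * esym x 3 (Suc N) = 6 * esym x 3 N + 3 * x N * (2 * esym x 2 N)"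
      by (simp add: numeral_3_eq_3 numeral_2_eq_2)
    then show ?case unfolding 2 Suc.IH sum.lessThan_Suc
      by (simp add: algebra_simps eval_nat_numeral)
  qed (simp add: numeral_3_eq_3)
  have 4: "24 * esym x 4 N = (\<Sum>j<N. x j) ^ 4 - 6 * (\<Sum>j<N. x j) ^ 2 * (\<Sum>j<N. x j ^ 2)
      + 3 * (\<Sum>j<N. x j ^ 2) ^ 2 + 8 * (\<Sum>j<N. x j) * (\<Sum>j<N. x j ^ 3) - 6 * (\<Sum>j<N. x j ^ 4)" for N
  proof (induction N)
    case (Suc N)
    have "24 * esym x 4 (Suc N) = 24 * esym x 4 N + 4 * x N * (6 * esym x 3 N)"
      by (simp add: eval_nat_numeral)
    then show ?case unfolding 3 Suc.IH sum.lessThan_Suc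
      by (simp add: algebra_simps eval_nat_numeral)
  qed (simp add: eval_nat_numeral)
  show "esym x (Suc 0) N = s 1"
    and "2 * esym x 2 N = s 1 ^ 2 - s 2"
    and "6 * esym x 3 N = s 1 ^ 3 - 3 * s 1 * s 2 + 2 * s 3"
    and "24 * esym x 4 N = s 1 ^ 4 - 6 * s 1 ^ 2 * s 2 + 3 * s 2 ^ 2 + 8 * s 1 * s 3 - 6 * s 4"
    unfolding s_def using 1 2 3 4 by simp_all
qed

text \<open>The constant coefficient is \<open>1 / 0 = 0\<close>, so this is \<open>- ln (1 - X)\<close>.\<close>

definition log_fps :: "rat fps" where
  "log_fps = Abs_fps (\<lambda>n. 1 / of_nat n)"

text \<open>The derivative of \<open>log_fps\<close> is \<open>1 / (1 - X)\<close>, and multiplying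
  by \<open>1 / (1 - X)\<close> forms partial sums. So differentiating a power reproduces the
  recursion \<open>esym_Suc_eq_sum\<close>. The variable with index 0 is
  \<open>1 / 0 = 0\<close>.\<close>

lemma log_fps_power_nth:
  "(log_fps ^ Suc n) $ N = fact (Suc n) / of_nat N * esym (\<lambda>j. 1 / of_nat j) n N"
proof (induction n arbitrary: N)
  case 0
  show ?case by (simp add: log_fps_def)
next
  case (Suc n)
  have deriv: "fps_deriv log_fps = Abs_fps (\<lambda>_. 1)"
    by (simp add: fps_eq_iff log_fps_def del: of_nat_Suc)
  show ?case
  proof (cases N)
    case 0
    then show ?thesis by (simp add: log_fps_def)
  next
    case (Suc M)
    have "of_nat N * (log_fps ^ Suc (Suc n)) $ N = fps_deriv (log_fps ^ Suc (Suc n)) $ M"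
      by (simp only: fps_deriv_nth Suc Suc_eq_plus1)
    also have "\<dots> = of_nat (Suc (Suc n)) * (log_fps ^ Suc n * Abs_fps (\<lambda>_. 1)) $ M"
      unfolding fps_deriv_power deriv
      by (simp add: fps_of_nat[symmetric] mult.assoc del: of_nat_Suc power_Suc) (simp add: mult_ac)
    also have "(log_fps ^ Suc n * Abs_fps (\<lambda>_. 1)) $ M = (\<Sum>i<N. (log_fps ^ Suc n) $ i)"
      using Suc by (simp add: fps_mult_nth atLeast0AtMost lessThan_Suc_atMost del: power_Suc)
    also have "\<dots> = fact (Suc n) * esym (\<lambda>j. 1 / of_nat j) (Suc n) N"
      unfolding Suc.IH esym_Suc_eq_sum by (simp add: sum_distrib_left)
    finally have "of_nat N * (log_fps ^ Suc (Suc n)) $ N = fact (Suc (Suc n)) * esym (\<lambda>j. 1 / of_nat j) (Suc n) N"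
      by (simp only: fact_Suc[of "Suc n"] of_nat_mult of_nat_fact mult.assoc)
    moreover have "of_nat N \<noteq> (0::rat)" using Suc by simp
    moreover have "a = f / n * e" if "n * a = f * e" "n \<noteq> 0" for a f e n :: rat
      using that by (simp add: field_simps)
    ultimately show ?thesis by blast
  qed
qed

text \<open>Faulhaber's formula: compare the coefficients of \<open>X^(m+1)\<close> in
  \<open>X (1 + e^X + ... + e^((N-1)X)) = B (e^(N X) - 1)\<close>, where
  \<open>B = X / (e^X - 1)\<close>.\<close>

lemma sum_powers_bernoulli:
  "(\<Sum>j<N. of_nat j ^ m) / fact m
     = (\<Sum>i\<le>m. bernoulli i / fact i * (of_nat N ^ (Suc m - i) / fact (Suc m - i)))"
proof -
  define E :: "rat fps" where "E = fps_exp 1"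
  define B where "B = Abs_fps (\<lambda>n. bernoulli n / fact n)"
  have E: "E ^ j = fps_exp (of_nat j)" for j
    unfolding E_def by (simp add: fps_exp_power_mult)
  have "(E - 1) * (\<Sum>j<N. E ^ j) = E ^ N - 1"
    by (simp add: power_diff_1_eq)
  then have "fps_X * (\<Sum>j<N. E ^ j) = B * (E ^ N - 1)"
    using bernoulli_generating_function unfolding B_def E_def by (metis mult.assoc)
  then have "(fps_X * (\<Sum>j<N. E ^ j)) $ Suc m = (B * (E ^ N - 1)) $ Suc m"
    by simp
  moreover have "(fps_X * (\<Sum>j<N. E ^ j)) $ Suc m = (\<Sum>j<N. of_nat j ^ m) / fact m"
    by (simp add: fps_sum_nth E sum_divide_distrib)
  moreover have "(B * (E ^ N - 1)) $ Suc m
      = (\<Sum>i\<le>m. bernoulli i / fact i * (of_nat N ^ (Suc m - i) / fact (Suc m - i)))"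
    unfolding fps_mult_nth by (simp add: atLeast0AtMost E B_def mult.commute)
  ultimately show ?thesis by simp
qed

context padic_gt_5
begin

lemma fact_unit: "n < p \<Longrightarrow> x \<in> p_integral p \<Longrightarrow> x / fact n \<in> p_integral p"
  using pint_divide_nat[of x "fact n"] prime_p by (simp add: prime_dvd_fact_iff)

text \<open>The recursion for \<open>bernoulli n / fact n\<close> divides only by factorials of
  numbers up to \<open>n + 1 < p\<close>, which are units.\<close>

lemma bernoulli_integral:
  assumes "n < p - 1"
  shows "bernoulli n \<in> p_integral p"
proof -
  have "bernoulli n / fact n \<in> p_integral p"
    using assms
  proof (induction n rule: less_induct)
    case (less n)
    have "(Abs_fps (\<lambda>n. bernoulli n / fact n) * (fps_exp 1 - 1)) $ Suc n = fps_X $ Suc n"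
      unfolding bernoulli_generating_function ..
    then have "(\<Sum>i\<le>n. bernoulli i / fact i * (1 / fact (Suc n - i))) = fps_X $ Suc n"
      unfolding fps_mult_nth by (simp add: atLeast0AtMost mult.commute)
    then have "bernoulli n / fact n = fps_X $ Suc n - (\<Sum>i<n. bernoulli i / fact i / fact (Suc n - i))"
      by (simp add: lessThan_Suc_atMost[symmetric])
    moreover have "(\<Sum>i<n. bernoulli i / fact i / fact (Suc n - i)) \<in> p_integral p"
      by (intro pint_sum fact_unit less.IH) (use less.prems in auto)
    moreover have "(fps_X :: rat fps) $ Suc n \<in> p_integral p"
      by (cases n) auto
    ultimately show ?case by (simp only: pint_diff)
  qed
  then have "of_nat (fact n) * (bernoulli n / fact n) \<in> p_integral p"
    by (intro pint_mult pint_of_nat)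
  then show ?thesis by simp
qed

text \<open>In \<open>sum_powers_bernoulli\<close> at \<open>N = p\<close> the summand
  \<open>i = m\<close> gives \<open>p B_m\<close>; all others contain \<open>p^2\<close> and have
  integral coefficients.\<close>

lemma sum_powers_cong:
  assumes "0 < m" "m < p - 1"
  shows "pcong 2 (\<Sum>j<p. of_nat j ^ m) (of_nat p * bernoulli m)"
proof -
  have "bernoulli i / fact i * (of_nat p ^ (Suc m - i) / fact (Suc m - i)) \<in> pideal 2" if "i < m" for i
  proof -
    have "bernoulli i / fact i / fact (Suc m - i) \<in> p_integral p"
      using that assms by (intro fact_unit bernoulli_integral) auto
    moreover have "of_nat p ^ (Suc m - i) \<in> pideal 2"
      using that by (intro pideal_mono[OF p_power_pideal]) auto
    ultimately have "bernoulli i / fact i / fact (Suc m - i) * of_nat p ^ (Suc m - i) \<in> pideal 2"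
      by (rule pideal_mult_integral(1)[rotated])
    then show ?thesis by (simp add: field_simps)
  qed
  then have "(\<Sum>i<m. bernoulli i / fact i * (of_nat p ^ (Suc m - i) / fact (Suc m - i))) \<in> pideal 2"
    by (intro pideal_sum) auto
  then have "(\<Sum>j<p. of_nat j ^ m) / fact m - bernoulli m / fact m * of_nat p \<in> pideal 2"
    unfolding sum_powers_bernoulli by (simp add: lessThan_Suc_atMost[symmetric])
  moreover have "fact m \<in> p_integral p" using pint_of_nat[of "fact m"] by simp
  ultimately have "fact m * ((\<Sum>j<p. of_nat j ^ m) / fact m - bernoulli m / fact m * of_nat p) \<in> pideal 2"
    by (rule pideal_mult_integral(1))
  then show ?thesis
    by (simp add: pcong_def right_diff_distrib mult.commute)
qed

end

section \<open>Sums of inverse powers\<close>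

context padic
begin

lemma pcong_power: "pcong k a b \<Longrightarrow> a \<in> p_integral p \<Longrightarrow> b \<in> p_integral p \<Longrightarrow> pcong k (a ^ n) (b ^ n)"
  by (induction n) (auto intro: pcong_mult)

lemma pcong_power_add_p:
  assumes "x \<in> p_integral p"
  shows "pcong 2 ((of_nat p + x) ^ Suc n) (x ^ Suc n + of_nat (Suc n) * of_nat p * x ^ n)"
proof (induction n)
  case (Suc n)
  have "pcong 2 ((of_nat p + x) * (of_nat p + x) ^ Suc n)
     ((of_nat p + x) * (x ^ Suc n + of_nat (Suc n) * of_nat p * x ^ n))"
    using Suc by (rule pcong_mult_left) (use assms in auto)
  also have "pcong 2 \<dots> (x ^ Suc (Suc n) + of_nat (Suc (Suc n)) * of_nat p * x ^ Suc n)"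
  proof -
    have "(of_nat p + x) * (x ^ Suc n + of_nat (Suc n) * of_nat p * x ^ n)
       - (x ^ Suc (Suc n) + of_nat (Suc (Suc n)) * of_nat p * x ^ Suc n) = of_nat p ^ 2 * (of_nat (Suc n) * x ^ n)"
      by (simp add: algebra_simps power2_eq_square)
    also have "\<dots> \<in> pideal 2" by (intro pidealI pints assms)
    finally show ?thesis by (simp add: pcong_def)
  qed
  finally show ?case by simp
qed (simp add: add.commute)

lemma fermat_pcong:
  assumes "\<not> p dvd j"
  shows "pcong 1 (of_nat j ^ (p - 1)) 1"
proof -
  have "[j ^ (p - 1) = 1] (mod p)" using fermat_theorem[OF prime_p assms] .
  then have "int p dvd int (j ^ (p - 1)) - 1"
    by (metis cong_int_iff cong_iff_dvd_diff of_nat_1)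
  then obtain c where "int (j ^ (p - 1)) - 1 = int p * c" by blast
  then have "of_int (int (j ^ (p - 1)) - 1) = (of_int (int p * c) :: rat)" by simp
  then have "of_nat j ^ (p - 1) - 1 = of_nat p ^ 1 * (of_int c :: rat)" by simp
  then show ?thesis using pidealI[of "of_int c" 1] by (simp add: pcong_def)
qed

definition inv_power_sum :: "nat \<Rightarrow> rat" where
  "inv_power_sum k = (\<Sum>j\<in>{0<..<p}. (1 / of_nat j) ^ k)"

lemma p_ndvd_less: "j \<in> {0<..<p} \<Longrightarrow> \<not> p dvd j"
  by (auto dest: dvd_imp_le)

lemma inv_integral: "\<not> p dvd j \<Longrightarrow> 1 / of_nat j \<in> p_integral p"
  by (intro pint_divide_nat pints)

lemma inv_power_sum_integral: "inv_power_sum k \<in> p_integral p"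
  unfolding inv_power_sum_def by (intro pint_sum pint_power inv_integral p_ndvd_less)

lemma sum_reflect: "(\<Sum>j\<in>{0<..<p}. f (p - j)) = (\<Sum>j\<in>{0<..<p}. f j)" for f :: "nat \<Rightarrow> rat"
  by (rule sum.reindex_bij_witness[where i = "\<lambda>j. p - j" and j = "\<lambda>j. p - j"]) auto

lemma inv_reflect_pcong:
  assumes "j \<in> {0<..<p}"
  shows "pcong 1 (1 / of_nat (p - j)) (- (1 / of_nat j))"
proof -
  have "1 / of_nat (p - j) - - (1 / of_nat j) = of_nat p * (1 / of_nat (p - j) * (1 / of_nat j) :: rat)"
    using assms by (simp add: field_simps of_nat_diff)
  also have "\<dots> \<in> pideal 1"
    using assms by (intro pideal_mult_integral(2) p_pideal pint_mult inv_integral p_ndvd_less) auto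
  finally show ?thesis by (simp add: pcong_def)
qed

text \<open>The geometric series of \<open>- (1 / j) / (1 - p / j)\<close>, cut off after two terms.
  With \<open>u = 1 / (q - x)\<close> and \<open>v = 1 / x\<close> the exact remainder follows from
  \<open>u + v = q u v\<close>.\<close>

lemma inv_reflect_pcong_2:
  assumes "j \<in> {0<..<p}"
  shows "pcong 2 (1 / of_nat (p - j)) (- (1 / of_nat j + of_nat p * (1 / of_nat j) ^ 2))"
proof -
  have *: "u - - (v + q * v ^ 2) = q ^ 2 * (v ^ 2 * u)" if "u * (q - x) = 1" "v * x = 1" for u v q x :: rat
  proof -
    have "q * u * v - v = u * (v * x) + (u * (q - x) - 1) * v" by (simp add: algebra_simps)
    then have "u + v - q * u * v = 0" using that by simp
    moreover have "u - - (v + q * v ^ 2) - q ^ 2 * (v ^ 2 * u) = (u + v - q * u * v) * (1 + q * v)"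
      by (simp add: algebra_simps power2_eq_square)
    ultimately show ?thesis by simp
  qed
  have "1 / of_nat (p - j) - - (1 / of_nat j + of_nat p * (1 / of_nat j) ^ 2)
      = of_nat p ^ 2 * ((1 / of_nat j) ^ 2 * (1 / of_nat (p - j)) :: rat)"
    using assms by (intro *[where x = "of_nat j"]) (auto simp: of_nat_diff)
  also have "\<dots> \<in> pideal 2"
    using assms by (intro pidealI pint_mult pint_power inv_integral p_ndvd_less) auto
  finally show ?thesis by (simp add: pcong_def)
qed

text \<open>The geometric series of \<open>(1 / j) / (1 + p / j)\<close>, cut off after three terms
  with an exact remainder.\<close>

lemma inv_shift_pcong:
  assumes "j \<in> {0<..<p}"
  shows "pcong 3 (1 / of_nat (p + j)) (1 / of_nat j - of_nat p * (1 / of_nat j) ^ 2 + of_nat p ^ 2 * (1 / of_nat j) ^ 3)"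
proof -
  have *: "u - (v - q * v ^ 2 + q ^ 2 * v ^ 3) = q ^ 3 * (- (v ^ 3 * u))"
    if "u * (q + x) = 1" "v * x = 1" for u v q x :: rat
  proof -
    have "v - q * u * v = u * (v * x) - (u * (q + x) - 1) * v" by (simp add: algebra_simps)
    then have "u - v + q * u * v = 0" using that by simp
    moreover have "u - (v - q * v ^ 2 + q ^ 2 * v ^ 3) - q ^ 3 * (- (v ^ 3 * u))
      = (u - v + q * u * v) * (1 - q * v + q ^ 2 * v ^ 2)"
      by (simp add: algebra_simps power2_eq_square power3_eq_cube)
    ultimately show ?thesis by simp
  qed
  have "1 / of_nat (p + j) - (1 / of_nat j - of_nat p * (1 / of_nat j) ^ 2 + of_nat p ^ 2 * (1 / of_nat j) ^ 3)
     = of_nat p ^ 3 * (- ((1 / of_nat j) ^ 3 * (1 / of_nat (p + j))) :: rat)"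
  proof (intro *[where x = "of_nat j"])
    have "of_nat (p + j) \<noteq> (0 :: rat)" using assms by (simp del: of_nat_add)
    then show "1 / of_nat (p + j) * (of_nat p + of_nat j) = (1 :: rat)" by simp
  qed (use assms in simp)
  also have "\<dots> \<in> pideal 3"
    using assms p_ndvd_less[OF assms] by (intro pidealI pint_uminus pint_mult pint_power inv_integral) auto
  finally show ?thesis by (simp add: pcong_def)
qed

text \<open>The nonzero residues split into pairs \<open>j, p - j\<close> and also into pairs
  \<open>2 j, p - 2 j\<close>, for \<open>j\<close> up to \<open>p div 2\<close>. If doubling the
  argument scales the summand, comparing the two forms restricts the sum.\<close>

lemma sum_halves:
  fixes \<theta> :: "nat \<Rightarrow> rat"
  assumes "odd p" and refl: "\<And>j. j \<in> {0<..<p} \<Longrightarrow> pcong k (\<theta> (p - j)) (\<theta> j)"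
  shows "pcong k (\<Sum>j\<in>{0<..<p}. \<theta> j) (2 * (\<Sum>j\<in>{0<..p div 2}. \<theta> j))"
    and "pcong k (\<Sum>j\<in>{0<..<p}. \<theta> j) (2 * (\<Sum>j\<in>{0<..p div 2}. \<theta> (2 * j)))"
proof -
  define h where "h = p div 2"
  have p: "p = 2 * h + 1" using \<open>odd p\<close> by (simp add: h_def)
  have "(\<Sum>j\<in>{0<..<p}. \<theta> j) = (\<Sum>j\<in>{0<..h} \<union> (\<lambda>j. p - j) ` {0<..h}. \<theta> j)"
  proof (rule sum.cong)
    have "j \<in> (\<lambda>j. p - j) ` {0<..h}" if "j \<in> {0<..<p}" "j > h" for j
      using that p by (intro image_eqI[of _ _ "p - j"]) auto
    then have "{0<..<p} \<subseteq> {0<..h} \<union> (\<lambda>j. p - j) ` {0<..h}"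
      by (metis UnCI greaterThanAtMost_iff greaterThanLessThan_iff leI subsetI)
    then show "{0<..<p} = {0<..h} \<union> (\<lambda>j. p - j) ` {0<..h}" using p by auto
  qed simp
  also have "\<dots> = (\<Sum>j\<in>{0<..h}. \<theta> j) + (\<Sum>j\<in>(\<lambda>j. p - j) ` {0<..h}. \<theta> j)"
    using p by (intro sum.union_disjoint) auto
  also have "(\<Sum>j\<in>(\<lambda>j. p - j) ` {0<..h}. \<theta> j) = (\<Sum>j\<in>{0<..h}. \<theta> (p - j))"
    using p by (subst sum.reindex) (auto simp: inj_on_def)
  also have "pcong k ((\<Sum>j\<in>{0<..h}. \<theta> j) + (\<Sum>j\<in>{0<..h}. \<theta> (p - j))) ((\<Sum>j\<in>{0<..h}. \<theta> j) + (\<Sum>j\<in>{0<..h}. \<theta> j))"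
    using p by (intro pcong_add pcong_refl pcong_sum refl) auto
  finally show "pcong k (\<Sum>j\<in>{0<..<p}. \<theta> j) (2 * (\<Sum>j\<in>{0<..p div 2}. \<theta> j))"
    by (simp add: h_def)
  have "(\<Sum>j\<in>{0<..<p}. \<theta> j) = (\<Sum>j\<in>(\<lambda>j. 2 * j) ` {0<..h} \<union> (\<lambda>j. p - 2 * j) ` {0<..h}. \<theta> j)"
  proof (rule sum.cong)
    have "j \<in> (\<lambda>j. 2 * j) ` {0<..h}" if "j \<in> {0<..<p}" "even j" for j
      using that p by (intro image_eqI[of _ _ "j div 2"]) auto
    moreover have "j \<in> (\<lambda>j. p - 2 * j) ` {0<..h}" if j: "j \<in> {0<..<p}" "odd j" for j
    proof -
      obtain i where "j = 2 * i + 1" using j(2) by (auto elim: oddE)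
      then show ?thesis using j(1) p by (intro image_eqI[of _ _ "h - i"]) auto
    qed
    ultimately have "{0<..<p} \<subseteq> (\<lambda>j. 2 * j) ` {0<..h} \<union> (\<lambda>j. p - 2 * j) ` {0<..h}"
      by blast
    then show "{0<..<p} = (\<lambda>j. 2 * j) ` {0<..h} \<union> (\<lambda>j. p - 2 * j) ` {0<..h}"
      using p by auto
  qed simp
  also have "\<dots> = (\<Sum>j\<in>(\<lambda>j. 2 * j) ` {0<..h}. \<theta> j) + (\<Sum>j\<in>(\<lambda>j. p - 2 * j) ` {0<..h}. \<theta> j)"
  proof (intro sum.union_disjoint)
    have "even j" if "j \<in> (\<lambda>j. 2 * j) ` {0<..h}" for j using that by auto
    moreover have "odd j" if "j \<in> (\<lambda>j. p - 2 * j) ` {0<..h}" for j using that p by auto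
    ultimately show "(\<lambda>j. 2 * j) ` {0<..h} \<inter> (\<lambda>j. p - 2 * j) ` {0<..h} = {}" by blast
  qed auto
  also have "(\<Sum>j\<in>(\<lambda>j. p - 2 * j) ` {0<..h}. \<theta> j) = (\<Sum>j\<in>{0<..h}. \<theta> (p - 2 * j))"
    using p by (subst sum.reindex) (auto simp: inj_on_def)
  also have "(\<Sum>j\<in>(\<lambda>j. 2 * j) ` {0<..h}. \<theta> j) = (\<Sum>j\<in>{0<..h}. \<theta> (2 * j))"
    by (subst sum.reindex) (auto simp: inj_on_def)
  also have "pcong k ((\<Sum>j\<in>{0<..h}. \<theta> (2 * j)) + (\<Sum>j\<in>{0<..h}. \<theta> (p - 2 * j)))
      ((\<Sum>j\<in>{0<..h}. \<theta> (2 * j)) + (\<Sum>j\<in>{0<..h}. \<theta> (2 * j)))"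
    using p by (intro pcong_add pcong_refl pcong_sum refl) auto
  finally show "pcong k (\<Sum>j\<in>{0<..<p}. \<theta> j) (2 * (\<Sum>j\<in>{0<..p div 2}. \<theta> (2 * j)))"
    by (simp add: h_def)
qed

end

section \<open>Divisibility of the sums of inverse powers\<close>

context padic_gt_5
begin

lemma odd_p: "odd p"
  using prime_p p_gt_5 prime_odd_nat by auto

lemma pideal_cancel:
  assumes "of_nat n * x \<in> pideal k" "\<not> p dvd n"
  shows "x \<in> pideal k"
proof -
  have "n \<noteq> 0" using assms(2) by (intro notI) simp
  then show ?thesis using pideal_divide_nat[OF assms] by simp
qed

lemma inv_power_sum_odd_mod_p:
  assumes "odd k"
  shows "inv_power_sum k \<in> pideal 1"
proof -
  have "pcong 1 (\<Sum>j\<in>{0<..<p}. (1 / of_nat (p - j)) ^ k) (\<Sum>j\<in>{0<..<p}. (- (1 / of_nat j)) ^ k)"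
    by (intro pcong_sum pcong_power inv_reflect_pcong pint_uminus inv_integral p_ndvd_less) auto
  also have "(\<Sum>j\<in>{0<..<p}. (1 / of_nat (p - j)) ^ k) = inv_power_sum k"
    unfolding inv_power_sum_def by (rule sum_reflect)
  also have "(\<Sum>j\<in>{0<..<p}. (- (1 / of_nat j)) ^ k) = - inv_power_sum k"
    unfolding inv_power_sum_def using assms by (simp add: sum_negf)
  finally have "of_nat 2 * inv_power_sum k \<in> pideal 1" by (simp add: pcong_def)
  then show ?thesis using p_ndvd_2 by (rule pideal_cancel)
qed

text \<open>Doubling the argument divides \<open>1 / j^k\<close> by \<open>2^k\<close>, so the two
  forms in \<open>sum_halves\<close> give \<open>(2^k - 1) H k = 0\<close> modulo
  \<open>p\<close>.\<close>

lemma inv_power_sum_even_mod_p: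
  assumes "even k" "\<not> p dvd 2 ^ k - 1"
  shows "inv_power_sum k \<in> pideal 1"
proof -
  define T where "T = (\<Sum>j\<in>{0<..p div 2}. (1 / of_nat j) ^ k :: rat)"
  have refl: "pcong 1 ((1 / of_nat (p - j)) ^ k) ((1 / of_nat j) ^ k)" if "j \<in> {0<..<p}" for j
  proof -
    have "pcong 1 ((1 / of_nat (p - j)) ^ k) ((- (1 / of_nat j)) ^ k)"
      using that by (intro pcong_power inv_reflect_pcong pint_uminus inv_integral p_ndvd_less) auto
    then show ?thesis using assms(1) by simp
  qed
  have 1: "pcong 1 (inv_power_sum k) (2 * T)"
    unfolding inv_power_sum_def T_def using odd_p refl by (rule sum_halves(1))
  have "pcong 1 (inv_power_sum k) (2 * (\<Sum>j\<in>{0<..p div 2}. (1 / of_nat (2 * j)) ^ k))"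
    unfolding inv_power_sum_def using odd_p refl by (rule sum_halves(2))
  also have "(\<Sum>j\<in>{0<..p div 2}. (1 / of_nat (2 * j)) ^ k) = T / 2 ^ k"
    unfolding T_def sum_divide_distrib by (simp add: power_divide power_mult_distrib mult.commute)
  finally have "pcong 1 (of_nat (2 ^ k) * inv_power_sum k) (of_nat (2 ^ k) * (2 * (T / 2 ^ k)))"
    by (rule pcong_mult_left) auto
  then have "pcong 1 (of_nat (2 ^ k) * inv_power_sum k) (2 * T)" by simp
  from pcong_trans[OF this pcong_sym[OF 1]] have "of_nat (2 ^ k - 1) * inv_power_sum k \<in> pideal 1"
    by (simp add: pcong_def of_nat_diff left_diff_distrib)
  then show ?thesis using assms(2) by (rule pideal_cancel)
qed

lemma inv_power_sum_mod_p: "inv_power_sum 2 \<in> pideal 1" "inv_power_sum 3 \<in> pideal 1" "inv_power_sum 4 \<in> pideal 1" "inv_power_sum 5 \<in> pideal 1"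
proof -
  \<comment> \<open>The numbers to be avoided are \<open>2^2 - 1 = 3\<close> and
    \<open>2^4 - 1 = 15\<close>.\<close>
  have "\<not> p dvd 15" using p_ndvd_mult[OF p_ndvd_3 p_ndvd_5] by simp
  then show "inv_power_sum 2 \<in> pideal 1" "inv_power_sum 4 \<in> pideal 1"
    using p_ndvd_3 by (intro inv_power_sum_even_mod_p; simp)+
  show "inv_power_sum 3 \<in> pideal 1" "inv_power_sum 5 \<in> pideal 1"
    by (intro inv_power_sum_odd_mod_p; simp)+
qed

text \<open>Wolstenholme's congruence: reflection modulo \<open>p^2\<close> gives
  \<open>2 H 1 = - p H 2\<close>, and \<open>p\<close> divides \<open>H 2\<close>.\<close>

lemma inv_sum_mod_p2: "inv_power_sum 1 \<in> pideal 2"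
proof -
  have "pcong 2 (\<Sum>j\<in>{0<..<p}. 1 / of_nat (p - j)) (\<Sum>j\<in>{0<..<p}. - (1 / of_nat j + of_nat p * (1 / of_nat j) ^ 2))"
    by (intro pcong_sum inv_reflect_pcong_2)
  also have "(\<Sum>j\<in>{0<..<p}. 1 / of_nat (p - j)) = inv_power_sum 1"
    unfolding inv_power_sum_def using sum_reflect[of "\<lambda>j. 1 / of_nat j"] by simp
  also have "(\<Sum>j\<in>{0<..<p}. - (1 / of_nat j + of_nat p * (1 / of_nat j) ^ 2)) = - inv_power_sum 1 - of_nat p * inv_power_sum 2"
    unfolding inv_power_sum_def by (simp add: sum_negf sum_subtractf sum.distrib sum_distrib_left)
  finally have "inv_power_sum 1 + inv_power_sum 1 + of_nat p * inv_power_sum 2 \<in> pideal 2" by (simp add: pcong_def add.assoc)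
  moreover have "of_nat p * inv_power_sum 2 \<in> pideal 2"
    using pideal_mult[OF p_pideal(1) inv_power_sum_mod_p(1)] by (simp add: numeral_2_eq_2)
  ultimately have "of_nat 2 * inv_power_sum 1 \<in> pideal 2" using pideal_diff by fastforce
  then show ?thesis using p_ndvd_2 by (rule pideal_cancel)
qed

end

section \<open>The base case\<close>

context padic_gt_5
begin

lemma odd_p_minus: "even (p - 5)" "p - 5 > 0" "p - 5 = Suc (p - 6)" "p - 1 = (p - 5) + 4" "p - 1 = (p - 6) + 5"
  using odd_p p_gt_5 by auto

text \<open>
  The coefficients \<open>5\<close> and \<open>- 4\<close> make the derivative \<open>- 20 x^(-5) - 4 (p - 5) x^(p-6)\<close> vanish
  modulo \<open>p\<close>, so that \<open>\<theta>\<close> is even modulo \<open>p^2\<close>.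
\<close>

lemma theta_reflect:
  fixes j :: nat
  defines "\<theta> \<equiv> \<lambda>j::nat. 5 * (1 / of_nat j) ^ 4 - 4 * of_nat j ^ (p - 5) :: rat"
  assumes j: "j \<in> {0<..<p}"
  shows "pcong 2 (\<theta> (p - j)) (\<theta> j)"
proof -
  define v :: rat where "v = 1 / of_nat j"
  define x :: rat where "x = of_nat j"
  define q :: rat where "q = of_nat p"
  have vx: "v * x = 1" using j by (simp add: v_def x_def)
  have int: "v \<in> p_integral p" "x \<in> p_integral p" "q \<in> p_integral p"
    unfolding v_def x_def q_def using p_ndvd_less[OF j] by (auto intro: inv_integral)
  have "pcong 2 ((1 / of_nat (p - j)) ^ 4) ((- (v + q * v ^ 2)) ^ 4)"
    unfolding v_def q_def using j
    by (intro pcong_power inv_reflect_pcong_2 pints inv_integral p_ndvd_less) auto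
  also have "pcong 2 \<dots> (v ^ 4 + 4 * q * v ^ 5)"
  proof -
    have "(- (v + q * v ^ 2)) ^ 4 - (v ^ 4 + 4 * q * v ^ 5) = q ^ 2 * (6 * v ^ 6 + 4 * q * v ^ 7 + q ^ 2 * v ^ 8)"
      by (simp add: algebra_simps eval_nat_numeral)
    also have "\<dots> \<in> pideal 2" unfolding q_def by (intro pidealI pints int)
    finally show ?thesis by (simp add: pcong_def)
  qed
  finally have 1: "pcong 2 ((1 / of_nat (p - j)) ^ 4) (v ^ 4 + 4 * q * v ^ 5)" .
  have "of_nat (p - j) = q + - x" using j by (simp add: q_def x_def of_nat_diff)
  have 2: "pcong 2 (of_nat (p - j) ^ (p - 5)) (x ^ (p - 5) - (q - 5) * q * x ^ (p - 6))"
  proof -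
    have *: "Suc (p - 6) = p - 5" "odd (p - 6)" "of_nat (p - 5) = q - 5"
      using p_gt_5 odd_p by (auto simp: q_def of_nat_diff)
    have "pcong 2 ((q + - x) ^ (p - 5)) ((- x) ^ (p - 5) + of_nat (p - 5) * q * (- x) ^ (p - 6))"
      using pcong_power_add_p[of "- x" "p - 6"] int unfolding *(1) q_def by auto
    also have "(- x) ^ (p - 5) = x ^ (p - 5)" using odd_p_minus(1) by simp
    also have "(- x) ^ (p - 6) = - (x ^ (p - 6))" using *(2) by simp
    finally show ?thesis using \<open>of_nat (p - j) = q + - x\<close> *(3) by simp
  qed
  have "pcong 2 (\<theta> (p - j)) (5 * (v ^ 4 + 4 * q * v ^ 5) - 4 * (x ^ (p - 5) - (q - 5) * q * x ^ (p - 6)))"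
    unfolding \<theta>_def by (intro pcong_diff pcong_mult_left 1 2 pints)
  also have "pcong 2 \<dots> (\<theta> j)"
  proof -
    have \<theta>_j: "\<theta> j = 5 * v ^ 4 - 4 * x ^ (p - 5)" by (simp add: \<theta>_def v_def x_def)
    \<comment> \<open>Since \<open>x^(p-6) = v^5 x^(p-1)\<close>, Fermat's theorem cancels the
      linear terms \<open>20 q v^5\<close> and \<open>- 20 q x^(p-6)\<close> modulo
      \<open>p^2\<close>.\<close>
    have "x ^ (p - 6) = x ^ (p - 6) * (v * x) ^ 5" by (simp add: vx)
    also have "\<dots> = v ^ 5 * x ^ (p - 1)" unfolding odd_p_minus(5) by (simp add: power_add power_mult_distrib)
    finally have "5 * (v ^ 4 + 4 * q * v ^ 5) - 4 * (x ^ (p - 5) - (q - 5) * q * x ^ (p - 6)) - \<theta> j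
      = q ^ 2 * (4 * x ^ (p - 6)) - (20 * v ^ 5) * (q * (x ^ (p - 1) - 1))"
      by (simp add: \<theta>_j algebra_simps power2_eq_square)
    also have "\<dots> \<in> pideal 2"
    proof (intro pideal_diff)
      show "q ^ 2 * (4 * x ^ (p - 6)) \<in> pideal 2" unfolding q_def by (intro pidealI pints int)
      have "q * (x ^ (p - 1) - 1) \<in> pideal (1 + 1)"
        using fermat_pcong[OF p_ndvd_less[OF j]] unfolding q_def x_def pcong_def by (intro pideal_mult p_pideal)
      then show "(20 * v ^ 5) * (q * (x ^ (p - 1) - 1)) \<in> pideal 2"
        by (intro pideal_mult_integral(1)[of _ 2 "20 * v ^ 5"] pints int) (simp add: numeral_2_eq_2)
    qed
    finally show ?thesis by (simp add: pcong_def)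
  qed
  finally show ?thesis .
qed

lemma power_pcong_inv:
  assumes "j \<in> {0<..<p}"
  shows "pcong 1 (of_nat j ^ (p - 5)) ((1 / of_nat j) ^ 4)"
proof -
  have "of_nat j ^ (p - 5) = (1 / of_nat j) ^ 4 * (of_nat j ^ (p - 1) :: rat)"
    using assms unfolding odd_p_minus(4) by (simp add: power_add power_divide)
  also have "pcong 1 \<dots> ((1 / of_nat j) ^ 4 * 1)"
    using p_ndvd_less[OF assms] by (intro pcong_mult_left fermat_pcong pint_power inv_integral)
  finally show ?thesis by simp
qed

text \<open>The sum \<open>T\<close> of \<open>\<theta>\<close> satisfies \<open>T = T / 16\<close>
  modulo \<open>p^2\<close> by comparing the two forms in \<open>sum_halves\<close>, so it vanishes.
  This trades \<open>5 H 4\<close> for four times a sum of positive powers, to which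
  \<open>sum_powers_cong\<close> applies.\<close>

lemma inv_power_sum_4_bernoulli: "pcong 2 (5 * inv_power_sum 4) (4 * (of_nat p * bernoulli (p - 5)))"
proof -
  define \<theta> where "\<theta> = (\<lambda>j::nat. 5 * (1 / of_nat j) ^ 4 - 4 * of_nat j ^ (p - 5) :: rat)"
  define T where "T = (\<Sum>j\<in>{0<..<p}. \<theta> j)"
  define P :: rat where "P = (\<Sum>j\<in>{0<..<p}. of_nat j ^ (p - 5))"
  define A where "A = (\<Sum>j\<in>{0<..p div 2}. \<theta> j)"
  define B :: rat where "B = (\<Sum>j\<in>{0<..p div 2}. of_nat j ^ (p - 5))"
  have refl: "pcong 2 (\<theta> (p - j)) (\<theta> j)" if "j \<in> {0<..<p}" for j
    using theta_reflect[OF that] by (simp add: \<theta>_def)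
  have T1: "pcong 2 T (2 * A)"
    unfolding T_def A_def using odd_p refl by (rule sum_halves(1))
  have T2: "pcong 2 T (2 * (\<Sum>j\<in>{0<..p div 2}. \<theta> (2 * j)))"
    unfolding T_def using odd_p refl by (rule sum_halves(2))
  \<comment> \<open>Doubling scales \<open>1 / j^4\<close> by \<open>1 / 16\<close> but
    \<open>j^(p-5)\<close> by \<open>2^(p-1) / 16\<close>; the second term is the mismatch.\<close>
  have "\<theta> (2 * j) = \<theta> j / 16 + (1 - 2 ^ (p - 1)) / 4 * of_nat j ^ (p - 5)" for j
    unfolding \<theta>_def odd_p_minus(4) by (simp add: power_add power_mult_distrib field_simps)
  then have T3: "2 * (\<Sum>j\<in>{0<..p div 2}. \<theta> (2 * j)) = 2 * A / 16 + (1 - 2 ^ (p - 1)) / 4 * (2 * B)"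
    by (simp add: A_def B_def sum.distrib sum_distrib_left sum_divide_distrib)
  have P1: "pcong 1 P (inv_power_sum 4)"
    unfolding P_def inv_power_sum_def by (intro pcong_sum power_pcong_inv)
  have "pcong 1 P (2 * B)"
    unfolding P_def B_def using odd_p
  proof (rule sum_halves(1))
    fix j assume j: "j \<in> {0<..<p}"
    have "pcong 1 (of_nat (p - j)) (- of_nat j)"
      using j by (simp add: pcong_def of_nat_diff)
    then have "pcong 1 (of_nat (p - j) ^ (p - 5)) ((- of_nat j) ^ (p - 5))"
      by (intro pcong_power pints)
    then show "pcong 1 (of_nat (p - j) ^ (p - 5)) (of_nat j ^ (p - 5))"
      using odd_p_minus(1) by simp
  qed
  \<comment> \<open>The mismatch vanishes modulo \<open>p^2\<close>: one factor \<open>p\<close>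
    comes from Fermat's theorem, the other from \<open>H 4\<close>.\<close>
  then have "2 * B \<in> pideal 1"
    using pideal_diff[OF inv_power_sum_mod_p(3), of "inv_power_sum 4 - P"] pcong_sym[OF P1] pideal_diff[of P 1 "P - 2 * B"]
    by (simp add: pcong_def)
  moreover have "1 - 2 ^ (p - 1) \<in> pideal 1"
    using pcong_sym[OF fermat_pcong[OF p_ndvd_2]] by (simp add: pcong_def)
  ultimately have B: "(1 - 2 ^ (p - 1)) * (2 * B) \<in> pideal 2"
    using pideal_mult[of "1 - 2 ^ (p - 1)" 1 "2 * B" 1] by (simp add: numeral_2_eq_2)
  have "of_nat 15 * T = of_nat 16 * (T - (2 * A / 16 + (1 - 2 ^ (p - 1)) / 4 * (2 * B)))
      - (T - 2 * A) + of_nat 4 * ((1 - 2 ^ (p - 1)) * (2 * B))"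
    by (simp add: field_simps)
  also have "\<dots> \<in> pideal 2"
    by (rule pideal_add[OF pideal_diff[OF pideal_mult_integral(1)[OF T2[unfolded T3 pcong_def]] T1[unfolded pcong_def]] pideal_mult_integral(1)[OF B]])
      (intro pints)+
  finally have "of_nat 15 * T \<in> pideal 2" .
  moreover have "\<not> p dvd 15" using p_ndvd_mult[OF p_ndvd_3 p_ndvd_5] by simp
  ultimately have "T \<in> pideal 2" by (rule pideal_cancel)
  moreover have "T = 5 * inv_power_sum 4 - 4 * P"
    by (simp add: T_def \<theta>_def inv_power_sum_def P_def sum_subtractf sum_distrib_left)
  ultimately have "pcong 2 (5 * inv_power_sum 4) (4 * P)" by (simp add: pcong_def)
  also have "P = (\<Sum>j<p. of_nat j ^ (p - 5))"
    unfolding P_def using odd_p_minus(2) p_pos by (intro sum.mono_neutral_left) auto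
  also have "pcong 2 (4 * (\<Sum>j<p. of_nat j ^ (p - 5))) (4 * (of_nat p * bernoulli (p - 5)))"
    using p_gt_5 by (intro pcong_mult_left sum_powers_cong pints) auto
  finally show ?thesis .
qed

text \<open>\<open>X^p W\<close> is the part of \<open>log_fps\<close> at the multiples of
  \<open>p\<close>. Up to degree \<open>2 p\<close> in the fifth power, only the coefficients of
  \<open>W\<close> recorded here matter.\<close>

lemma inv_fps_eq_log:
  "\<exists>W. W $ 0 = 1 / of_nat p \<and> (\<forall>i. 0 < i \<and> i < p \<longrightarrow> W $ i = 0) \<and> inv_fps = log_fps - fps_X ^ p * W"
proof (intro exI conjI allI impI)
  define W where "W = Abs_fps (\<lambda>n. if p dvd n then 1 / of_nat (n + p) else 0 :: rat)"
  show "W $ 0 = 1 / of_nat p" by (simp add: W_def)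
  show "W $ i = 0" if "0 < i \<and> i < p" for i using that by (auto simp: W_def dest: dvd_imp_le)
  show "inv_fps = log_fps - fps_X ^ p * W"
  proof (rule fps_ext)
    fix n
    have "p dvd n - p \<longleftrightarrow> p dvd n" if "p \<le> n" using that by (metis dvd_minus_self not_less)
    moreover have "p dvd n \<Longrightarrow> n < p \<Longrightarrow> n = 0" by (auto dest: dvd_imp_le)
    ultimately show "inv_fps $ n = (log_fps - fps_X ^ p * W) $ n"
      by (auto simp: inv_fps_def log_fps_def fps_X_power_mult_nth W_def)
  qed
qed

text \<open>Expand \<open>(log_fps - X^p W)^5\<close>. As \<open>log_fps\<close> has no constant
  term, the part linear in \<open>W\<close> starts above degree \<open>p\<close> and the quadratic
  part above \<open>2 p\<close>.\<close>

lemma comp_sum_p_eq: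
  "comp_sum p = (log_fps ^ 5) $ p" "comp_sum (2 * p) = (log_fps ^ 5) $ (2 * p) - 5 / of_nat p * (log_fps ^ 4) $ p"
proof -
  obtain W where W: "W $ 0 = 1 / of_nat p" "\<And>i. 0 < i \<Longrightarrow> i < p \<Longrightarrow> W $ i = 0" "inv_fps = log_fps - fps_X ^ p * W"
    using inv_fps_eq_log by blast
  define h where "h = log_fps"
  define R where "R = - 10 * h ^ 2 * W ^ 3 + 5 * h * fps_X ^ p * W ^ 4 - (fps_X ^ p) ^ 2 * W ^ 5"
  have h0: "(h ^ Suc k) $ 0 = 0" for k by (simp add: h_def log_fps_def)
  have X: "(fps_X ^ p) ^ 2 = (fps_X ^ (2 * p) :: rat fps)" "(fps_X ^ p) ^ 3 = (fps_X ^ (3 * p) :: rat fps)"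
    by (simp_all add: power_mult[symmetric] mult.commute)
  have "inv_fps ^ 5 = h ^ 5 - 5 * (fps_X ^ p * (h ^ 4 * W)) + (fps_X ^ p) ^ 2 * (10 * (h ^ 3 * W ^ 2)) + (fps_X ^ p) ^ 3 * R"
    unfolding W(3) R_def h_def[symmetric] by (simp add: algebra_simps eval_nat_numeral)
  then have F5: "inv_fps ^ 5 = h ^ 5 - 5 * (fps_X ^ p * (h ^ 4 * W)) + fps_X ^ (2 * p) * (10 * (h ^ 3 * W ^ 2)) + fps_X ^ (3 * p) * R"
    unfolding X .
  have five: "(5 * A) $ n = 5 * A $ n" "(10 * A) $ n = 10 * A $ n" for A :: "rat fps" and n
    by (simp_all add: numeral_fps_const)
  show "comp_sum p = (log_fps ^ 5) $ p"
    unfolding comp_sum_def F5 using p_pos h0[of 3] by (simp add: five fps_X_power_mult_nth h_def[symmetric] eval_nat_numeral)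
  have "(h ^ 4 * W) $ p = (\<Sum>i\<in>{0..p}. (h ^ 4) $ i * W $ (p - i))" by (rule fps_mult_nth)
  \<comment> \<open>\<open>W\<close> vanishes strictly between degrees 0 and \<open>p\<close>, and
    \<open>h^4\<close> has no constant term.\<close>
  also have "\<dots> = (\<Sum>i\<in>{p}. (h ^ 4) $ i * W $ (p - i))"
  proof (rule sum.mono_neutral_right)
    show "\<forall>i\<in>{0..p} - {p}. (h ^ 4) $ i * W $ (p - i) = 0"
    proof
      fix i assume "i \<in> {0..p} - {p}"
      then show "(h ^ 4) $ i * W $ (p - i) = 0"
        using h0[of 3] W(2)[of "p - i"] by (cases "i = 0") auto
    qed
  qed auto
  finally have "(h ^ 4 * W) $ p = (h ^ 4) $ p / of_nat p" using W(1) by simp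
  then show "comp_sum (2 * p) = (log_fps ^ 5) $ (2 * p) - 5 / of_nat p * (log_fps ^ 4) $ p"
    unfolding comp_sum_def F5 using p_pos h0[of 2] by (simp add: five fps_X_power_mult_nth h_def[symmetric])
qed

abbreviation inv_nat :: "nat \<Rightarrow> rat" where
  "inv_nat \<equiv> \<lambda>j. 1 / of_nat j"

text \<open>For \<open>2 p\<close> the variable \<open>1 / p\<close> is split off by
  \<open>esym_change_one\<close>; what remains are the inverses of the numbers below
  \<open>2 p\<close> prime to \<open>p\<close>. Powers of \<open>p\<close> clear the
  denominators.\<close>

lemma comp_sum_p_esym:
  "of_nat p * comp_sum p = 120 * esym inv_nat 4 p"
  "of_nat p ^ 2 * comp_sum (2 * p) = 60 * of_nat p * esym (fps_nth inv_fps) 4 (2 * p)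
     + 60 * (esym (fps_nth inv_fps) 3 (2 * p) - 2 * esym inv_nat 3 p)"
proof -
  have p0: "of_nat p \<noteq> (0 :: rat)" using p_pos by simp
  have h: "(log_fps ^ 5) $ N = 120 / of_nat N * esym inv_nat 4 N" "(log_fps ^ 4) $ N = 24 / of_nat N * esym inv_nat 3 N" for N
    using log_fps_power_nth[of 4 N] log_fps_power_nth[of 3 N] by (simp_all add: fact_numeral eval_nat_numeral)
  show "of_nat p * comp_sum p = 120 * esym inv_nat 4 p"
    using p0 by (simp add: comp_sum_p_eq h)
  have "inv_nat j = inv_fps $ j" if "j \<noteq> p" "j < 2 * p" for j
  proof (cases "p dvd j")
    case True
    then obtain k where "j = p * k" by blast
    then have "j = 0" using that by (cases k; cases "k - 1") auto
    then show ?thesis by (simp add: inv_fps_def)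
  qed (simp add: inv_fps_def)
  \<comment> \<open>\<open>esym_change_one\<close> requires agreement at every index except
    \<open>p\<close>, while \<open>inv_fps\<close> and \<open>inv_nat\<close> also differ at
    multiples of \<open>p\<close> from \<open>2 p\<close> on; hence the patched sequence.\<close>
  define y where "y = (\<lambda>j. if j < 2 * p then inv_fps $ j else inv_nat j)"
  have y: "esym y k (2 * p) = esym (fps_nth inv_fps) k (2 * p)" for k
    by (rule esym_cong) (simp add: y_def)
  have "esym inv_nat (Suc 3) (2 * p) = esym y (Suc 3) (2 * p) + inv_nat p * esym y 3 (2 * p)"
    using p_pos \<open>\<And>j. j \<noteq> p \<Longrightarrow> j < 2 * p \<Longrightarrow> inv_nat j = inv_fps $ j\<close>
    by (intro esym_change_one) (auto simp: y_def inv_fps_def)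
  then have "esym inv_nat 4 (2 * p) = esym (fps_nth inv_fps) 4 (2 * p) + inv_nat p * esym (fps_nth inv_fps) 3 (2 * p)"
    unfolding y by simp
  then have "comp_sum (2 * p) = 120 / of_nat (2 * p) * (esym (fps_nth inv_fps) 4 (2 * p) + inv_nat p * esym (fps_nth inv_fps) 3 (2 * p))
      - 5 / of_nat p * (24 / of_nat p * esym inv_nat 3 p)"
    by (simp only: comp_sum_p_eq h)
  then show "of_nat p ^ 2 * comp_sum (2 * p) = 60 * of_nat p * esym (fps_nth inv_fps) 4 (2 * p)
     + 60 * (esym (fps_nth inv_fps) 3 (2 * p) - 2 * esym inv_nat 3 p)"
    using p0 by (simp only:) (simp add: field_simps power2_eq_square)
qed

section \<open>Power sums over the numbers below \<open>2 p\<close> prime to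
  \<open>p\<close>\<close>

lemma sum_inv_fps_powers:
  assumes "k > 0"
  shows "(\<Sum>j<2 * p. (inv_fps $ j) ^ k) = inv_power_sum k + (\<Sum>j\<in>{0<..<p}. (1 / of_nat (p + j)) ^ k)"
proof -
  have "(\<Sum>j<2 * p. (inv_fps $ j) ^ k) = (\<Sum>j\<in>{0<..<p} \<union> (\<lambda>j. p + j) ` {0<..<p}. (inv_fps $ j) ^ k)"
  proof (rule sum.mono_neutral_right)
    show "\<forall>j\<in>{..<2 * p} - ({0<..<p} \<union> (\<lambda>j. p + j) ` {0<..<p}). (inv_fps $ j) ^ k = 0"
    proof
      fix j assume j: "j \<in> {..<2 * p} - ({0<..<p} \<union> (\<lambda>j. p + j) ` {0<..<p})"
      have "j = 0 \<or> j = p"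
      proof (rule ccontr)
        assume "\<not> (j = 0 \<or> j = p)"
        then have "j > p" "j - p < p" using j by auto
        then have "j \<in> (\<lambda>j. p + j) ` {0<..<p}" by (intro image_eqI[of _ _ "j - p"]) auto
        then show False using j by blast
      qed
      then show "(inv_fps $ j) ^ k = 0" using assms by (auto simp: inv_fps_def)
    qed
  qed auto
  also have "\<dots> = (\<Sum>j\<in>{0<..<p}. (inv_fps $ j) ^ k) + (\<Sum>j\<in>(\<lambda>j. p + j) ` {0<..<p}. (inv_fps $ j) ^ k)"
    by (intro sum.union_disjoint) auto
  also have "(\<Sum>j\<in>(\<lambda>j. p + j) ` {0<..<p}. (inv_fps $ j) ^ k) = (\<Sum>j\<in>{0<..<p}. (inv_fps $ (p + j)) ^ k)"
    by (subst sum.reindex) auto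
  also have "\<dots> = (\<Sum>j\<in>{0<..<p}. (1 / of_nat (p + j)) ^ k)"
  proof (intro sum.cong refl arg_cong[where f = "\<lambda>x. x ^ k"])
    fix j assume "j \<in> {0<..<p}"
    then show "inv_fps $ (p + j) = 1 / of_nat (p + j)" using p_ndvd_less by (simp add: inv_fps_def)
  qed
  also have "(\<Sum>j\<in>{0<..<p}. (inv_fps $ j) ^ k) = inv_power_sum k"
    unfolding inv_power_sum_def using p_ndvd_less by (intro sum.cong refl) (simp add: inv_fps_def)
  finally show ?thesis .
qed

lemma inv_shift_power_pcong:
  assumes "j \<in> {0<..<p}"
  shows "pcong 2 (1 / of_nat (p + j)) (1 / of_nat j - of_nat p * (1 / of_nat j) ^ 2)"
    and "pcong 1 ((1 / of_nat (p + j)) ^ 2) ((1 / of_nat j) ^ 2)"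
    and "pcong 3 ((1 / of_nat (p + j)) ^ 3)
      ((1 / of_nat j) ^ 3 - 3 * of_nat p * (1 / of_nat j) ^ 4 + 6 * of_nat p ^ 2 * (1 / of_nat j) ^ 5)"
    and "pcong 2 ((1 / of_nat (p + j)) ^ 4) ((1 / of_nat j) ^ 4 - 4 * of_nat p * (1 / of_nat j) ^ 5)"
proof -
  define u :: rat where "u = 1 / of_nat (p + j)"
  define v :: rat where "v = 1 / of_nat j"
  define q :: rat where "q = of_nat p"
  have int: "u \<in> p_integral p" "v \<in> p_integral p" "q \<in> p_integral p"
    using p_ndvd_less[OF assms] by (auto simp: u_def v_def q_def simp del: of_nat_add intro!: inv_integral)
  have 3: "pcong 3 u (v - q * v ^ 2 + q ^ 2 * v ^ 3)"
    unfolding u_def v_def q_def by (rule inv_shift_pcong[OF assms])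
  have step: "pcong k a c" if "pcong k a b" "b - c = q ^ k * d" "d \<in> p_integral p" for k a b c d
  proof -
    have "pcong k b c" unfolding pcong_def that(2) using pidealI[OF that(3), of k] by (simp add: q_def)
    with that(1) show ?thesis by (rule pcong_trans)
  qed
  show 2: "pcong 2 (1 / of_nat (p + j)) (1 / of_nat j - of_nat p * (1 / of_nat j) ^ 2)"
    unfolding u_def[symmetric] v_def[symmetric] q_def[symmetric]
    by (rule step[OF pcong_mono[OF 3], of 2 _ "v ^ 3"]) (auto intro: pints int)
  have 1: "pcong 1 u v"
    by (rule step[OF pcong_mono[OF 3], of 1 _ "- (v ^ 2) + q * v ^ 3"])
      (auto intro: pints int simp: algebra_simps power2_eq_square)
  show "pcong 1 ((1 / of_nat (p + j)) ^ 2) ((1 / of_nat j) ^ 2)"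
    unfolding u_def[symmetric] v_def[symmetric] by (intro pcong_power 1 int)
  show "pcong 3 ((1 / of_nat (p + j)) ^ 3)
      ((1 / of_nat j) ^ 3 - 3 * of_nat p * (1 / of_nat j) ^ 4 + 6 * of_nat p ^ 2 * (1 / of_nat j) ^ 5)"
    unfolding u_def[symmetric] v_def[symmetric] q_def[symmetric]
  proof (rule step)
    show "pcong 3 (u ^ 3) ((v - q * v ^ 2 + q ^ 2 * v ^ 3) ^ 3)"
      by (intro pcong_power 3 pints int)
    \<comment> \<open>The constants come from \<open>(1 - t + t^2)^3 = 1 - 3 t + 6 t^2 - 7 t^3 + 6
      t^4 - 3 t^5 + t^6\<close> at \<open>t = q v\<close>.\<close>
    show "(v - q * v ^ 2 + q ^ 2 * v ^ 3) ^ 3 - (v ^ 3 - 3 * q * v ^ 4 + 6 * q ^ 2 * v ^ 5)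
      = q ^ 3 * (- 7 * v ^ 6 + 6 * q * v ^ 7 - 3 * q ^ 2 * v ^ 8 + q ^ 3 * v ^ 9)"
      by (simp add: algebra_simps eval_nat_numeral)
    show "- 7 * v ^ 6 + 6 * q * v ^ 7 - 3 * q ^ 2 * v ^ 8 + q ^ 3 * v ^ 9 \<in> p_integral p"
      by (intro pints int)
  qed
  show "pcong 2 ((1 / of_nat (p + j)) ^ 4) ((1 / of_nat j) ^ 4 - 4 * of_nat p * (1 / of_nat j) ^ 5)"
    unfolding u_def[symmetric] v_def[symmetric] q_def[symmetric]
  proof (rule step)
    show "pcong 2 (u ^ 4) ((v - q * v ^ 2) ^ 4)"
      using 2 unfolding u_def[symmetric] v_def[symmetric] q_def[symmetric] by (intro pcong_power pints int)
    show "(v - q * v ^ 2) ^ 4 - (v ^ 4 - 4 * q * v ^ 5) = q ^ 2 * (6 * v ^ 6 - 4 * q * v ^ 7 + q ^ 2 * v ^ 8)"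
      by (simp add: algebra_simps eval_nat_numeral)
    show "6 * v ^ 6 - 4 * q * v ^ 7 + q ^ 2 * v ^ 8 \<in> p_integral p"
      by (intro pints int)
  qed
qed

lemma p_mult_inv_power_sum: "of_nat p * inv_power_sum 2 \<in> pideal 2" "of_nat p * inv_power_sum 5 \<in> pideal 2" "of_nat p ^ 2 * inv_power_sum 5 \<in> pideal 3"
  using pideal_mult[OF p_pideal(1) inv_power_sum_mod_p(1)] pideal_mult[OF p_pideal(1) inv_power_sum_mod_p(4)] pideal_mult[OF p_power_pideal[of 2] inv_power_sum_mod_p(4)]
  by (simp_all add: eval_nat_numeral)

lemma sum_inv_fps_powers_cong:
  shows "(\<Sum>j<2 * p. inv_fps $ j) \<in> pideal 2" "(\<Sum>j<2 * p. (inv_fps $ j) ^ 2) \<in> pideal 1"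
    and "pcong 3 (\<Sum>j<2 * p. (inv_fps $ j) ^ 3) (2 * inv_power_sum 3 - 3 * of_nat p * inv_power_sum 4)"
    and "pcong 2 (\<Sum>j<2 * p. (inv_fps $ j) ^ 4) (2 * inv_power_sum 4)"
proof -
  have "pcong 2 (\<Sum>j\<in>{0<..<p}. 1 / of_nat (p + j)) (inv_power_sum 1 - of_nat p * inv_power_sum 2)"
    unfolding inv_power_sum_def power_one_right sum_distrib_left sum_subtractf[symmetric]
    by (intro pcong_sum inv_shift_power_pcong(1))
  from pideal_add[OF inv_sum_mod_p2 pideal_add[OF this[unfolded pcong_def] pideal_diff[OF inv_sum_mod_p2 p_mult_inv_power_sum(1)]]]
  show "(\<Sum>j<2 * p. inv_fps $ j) \<in> pideal 2" using sum_inv_fps_powers[of 1] by simp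
  have "pcong 1 (\<Sum>j\<in>{0<..<p}. (1 / of_nat (p + j)) ^ 2) (inv_power_sum 2)"
    unfolding inv_power_sum_def by (intro pcong_sum inv_shift_power_pcong(2))
  from pideal_add[OF inv_power_sum_mod_p(1) pideal_add[OF this[unfolded pcong_def] inv_power_sum_mod_p(1)]]
  show "(\<Sum>j<2 * p. (inv_fps $ j) ^ 2) \<in> pideal 1" using sum_inv_fps_powers[of 2] by simp
  have "pcong 3 (\<Sum>j\<in>{0<..<p}. (1 / of_nat (p + j)) ^ 3) (inv_power_sum 3 - 3 * of_nat p * inv_power_sum 4 + 6 * of_nat p ^ 2 * inv_power_sum 5)"
    unfolding inv_power_sum_def sum_distrib_left sum_subtractf[symmetric] sum.distrib[symmetric]
    by (intro pcong_sum inv_shift_power_pcong(3))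
  from pideal_add[OF this[unfolded pcong_def] pideal_mult_integral(1)[OF p_mult_inv_power_sum(3), of 6]]
  show "pcong 3 (\<Sum>j<2 * p. (inv_fps $ j) ^ 3) (2 * inv_power_sum 3 - 3 * of_nat p * inv_power_sum 4)"
    using sum_inv_fps_powers[of 3] by (simp add: pcong_def algebra_simps)
  have "pcong 2 (\<Sum>j\<in>{0<..<p}. (1 / of_nat (p + j)) ^ 4) (inv_power_sum 4 - 4 * of_nat p * inv_power_sum 5)"
    unfolding inv_power_sum_def sum_distrib_left sum_subtractf[symmetric]
    by (intro pcong_sum inv_shift_power_pcong(4))
  from pideal_diff[OF this[unfolded pcong_def] pideal_mult_integral(1)[OF p_mult_inv_power_sum(2), of 4]]
  show "pcong 2 (\<Sum>j<2 * p. (inv_fps $ j) ^ 4) (2 * inv_power_sum 4)"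
    using sum_inv_fps_powers[of 4] by (simp add: pcong_def algebra_simps)
qed

text \<open>In Newton's identities \<open>s 1 * s 2\<close> and \<open>s 1 ^ 3\<close> vanish modulo
  \<open>p^3\<close>, and multiples of \<open>s 1\<close> and \<open>s 2 ^ 2\<close> vanish modulo
  \<open>p^2\<close>; only the last power sum survives.\<close>

lemma esym_cong_power_sum:
  fixes x :: "nat \<Rightarrow> rat" and N :: nat
  defines "s \<equiv> \<lambda>k. \<Sum>j<N. x j ^ k"
  assumes s: "s 1 \<in> pideal 2" "s 2 \<in> pideal 1" "s 3 \<in> p_integral p"
  shows "pcong 3 (6 * esym x 3 N) (2 * s 3)" "pcong 2 (24 * esym x 4 N) (- 6 * s 4)"
proof -
  have int: "s 1 \<in> p_integral p" "s 2 \<in> p_integral p"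
    using s pideal_integral by blast+
  have "s 1 * s 2 \<in> pideal 3" using pideal_mult[OF s(1,2)] by simp
  moreover have "s 1 * s 1 \<in> pideal 3" using pideal_mono[OF pideal_mult[OF s(1,1)], of 3] by simp
  ultimately have "s 1 * (s 1 * s 1) - 3 * (s 1 * s 2) \<in> pideal 3"
    using pideal_diff[OF pideal_mult_integral(1)[OF _ int(1)] pideal_mult_integral(1)[of _ 3 3]] by blast
  then show "pcong 3 (6 * esym x 3 N) (2 * s 3)"
    using esym_newton(3)[of x N] by (simp add: pcong_def s_def power3_eq_cube mult.assoc)
  have "s 2 * s 2 \<in> pideal 2" using pideal_mult[OF s(2,2)] by (simp add: numeral_2_eq_2)
  from pideal_add[OF pideal_mult_integral(1)[OF s(1)] pideal_mult_integral(1)[OF this]]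
  have "(s 1 ^ 3 - 6 * s 1 * s 2 + 8 * s 3) * s 1 + 3 * (s 2 * s 2) \<in> pideal 2"
    by this (intro pints int s(3))+
  moreover have "24 * esym x 4 N = s 1 ^ 4 - 6 * s 1 ^ 2 * s 2 + 3 * s 2 ^ 2 + 8 * s 1 * s 3 - 6 * s 4"
    unfolding s_def by (rule esym_newton(4))
  then have "24 * esym x 4 N - (- 6 * s 4) = (s 1 ^ 3 - 6 * s 1 * s 2 + 8 * s 3) * s 1 + 3 * (s 2 * s 2)"
    by (simp add: algebra_simps eval_nat_numeral)
  ultimately show "pcong 2 (24 * esym x 4 N) (- 6 * s 4)" by (simp add: pcong_def)
qed

lemma sum_inv_powers: "k > 0 \<Longrightarrow> (\<Sum>j<p. inv_nat j ^ k) = inv_power_sum k"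
  unfolding inv_power_sum_def using p_pos by (intro sum.mono_neutral_right) auto

lemma esym_inv_cong: "pcong 3 (6 * esym inv_nat 3 p) (2 * inv_power_sum 3)" "pcong 2 (24 * esym inv_nat 4 p) (- 6 * inv_power_sum 4)"
  using esym_cong_power_sum[where x = inv_nat and N = p] inv_sum_mod_p2 inv_power_sum_mod_p inv_power_sum_integral sum_inv_powers[of 1]
  by (simp_all add: sum_inv_powers)

lemma esym_inv_fps_cong:
  "pcong 3 (6 * esym (fps_nth inv_fps) 3 (2 * p)) (4 * inv_power_sum 3 - 6 * of_nat p * inv_power_sum 4)"
  "pcong 2 (24 * esym (fps_nth inv_fps) 4 (2 * p)) (- 12 * inv_power_sum 4)"
proof -
  have "inv_fps $ j \<in> p_integral p" for j using inv_fps_integral by (simp add: integral_fps_def)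
  then have "(\<Sum>j<2 * p. (inv_fps $ j) ^ 3) \<in> p_integral p" by (intro pint_sum pint_power)
  then have *: "pcong 3 (6 * esym (fps_nth inv_fps) 3 (2 * p)) (2 * (\<Sum>j<2 * p. (inv_fps $ j) ^ 3))"
    "pcong 2 (24 * esym (fps_nth inv_fps) 4 (2 * p)) (- 6 * (\<Sum>j<2 * p. (inv_fps $ j) ^ 4))"
    using sum_inv_fps_powers_cong esym_cong_power_sum[where x = "fps_nth inv_fps" and N = "2 * p"] by simp_all
  show "pcong 3 (6 * esym (fps_nth inv_fps) 3 (2 * p)) (4 * inv_power_sum 3 - 6 * of_nat p * inv_power_sum 4)"
    using pcong_trans[OF *(1) pcong_mult_left[OF sum_inv_fps_powers_cong(3), of 2]] by (simp add: algebra_simps)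
  show "pcong 2 (24 * esym (fps_nth inv_fps) 4 (2 * p)) (- 12 * inv_power_sum 4)"
    using pcong_trans[OF *(2) pcong_mult_left[OF sum_inv_fps_powers_cong(4), of "- 6"]] by (simp add: pint_uminus)
qed

lemma pcong_divide_p:
  assumes "pcong (k + j) (of_nat p ^ j * a) (of_nat p ^ j * b)"
  shows "pcong k a b"
  using pideal_divide_p[of "of_nat p ^ j * a - of_nat p ^ j * b" k j] assms p_pos
  by (simp add: pcong_def diff_divide_distrib)

text \<open>Modulo \<open>p^2\<close>,
  \<open>p U p = 5 * 24 e_4 = - 30 H 4 = - 6 * 5 H 4 = - 24 p B\<close>; dividing by
  \<open>p\<close> costs one power of the modulus.\<close>

lemma comp_sum_p_cong: "pcong 1 (comp_sum p) (- 24 * bernoulli (p - 5))"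
proof -
  have "pcong 2 (of_nat p * comp_sum p) (- 30 * inv_power_sum 4)"
    using pcong_mult_left[OF esym_inv_cong(2), of 5] by (simp add: comp_sum_p_esym)
  also have "pcong 2 (- 30 * inv_power_sum 4) (of_nat p * (- 24 * bernoulli (p - 5)))"
    using pcong_mult_left[OF inv_power_sum_4_bernoulli, of "- 6"] by (simp add: pint_uminus mult_ac)
  finally show ?thesis using pcong_divide_p[of 1 1] by (simp add: numeral_2_eq_2)
qed

text \<open>Multiplied by \<open>2 p^2\<close>, both sides equal \<open>- 180 p H 4\<close> modulo
  \<open>p^3\<close>: the contributions of \<open>H 3\<close> cancel between the two symmetric
  functions of degree 3. The letters \<open>a\<close> to \<open>d\<close> name the errors of the
  four congruences.\<close>

lemma comp_sum_2p_cong: "pcong 1 (comp_sum (2 * p)) (3 * comp_sum p)"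
proof -
  define q :: rat where "q = of_nat p"
  define a where "a = 24 * esym (fps_nth inv_fps) 4 (2 * p) - (- 12 * inv_power_sum 4)"
  define b where "b = 6 * esym (fps_nth inv_fps) 3 (2 * p) - (4 * inv_power_sum 3 - 6 * q * inv_power_sum 4)"
  define c where "c = 6 * esym inv_nat 3 p - 2 * inv_power_sum 3"
  define d where "d = 24 * esym inv_nat 4 p - (- 6 * inv_power_sum 4)"
  have mem: "a \<in> pideal 2" "b \<in> pideal 3" "c \<in> pideal 3" "d \<in> pideal 2"
    using esym_inv_fps_cong esym_inv_cong unfolding a_def b_def c_def d_def pcong_def q_def by blast+
  have q2: "q * a \<in> pideal 3" "q * d \<in> pideal 3"
    using pideal_mult[OF p_pideal(1) mem(1)] pideal_mult[OF p_pideal(1) mem(4)] by (simp_all add: q_def numeral_eq_Suc)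
  have Up: "q * (q * comp_sum p) = q * (5 * (24 * esym inv_nat 4 p))"
    by (simp add: comp_sum_p_esym q_def)
  have "of_nat 2 * (q ^ 2 * comp_sum (2 * p) - q ^ 2 * (3 * comp_sum p)) = 5 * (q * a) + 20 * (b - 2 * c) - 30 * (q * d)"
  proof -
    have "of_nat 2 * (q ^ 2 * comp_sum (2 * p) - q ^ 2 * (3 * comp_sum p)) = 2 * (q ^ 2 * comp_sum (2 * p)) - 6 * (q * (q * comp_sum p))"
      by (simp add: power2_eq_square algebra_simps)
    then show ?thesis
      unfolding Up comp_sum_p_esym(2)[folded q_def] a_def b_def c_def d_def by (simp add: algebra_simps)
  qed
  also have "\<dots> \<in> pideal 3"
    by (intro pideal_add pideal_diff pideal_mult_integral(1) q2 mem pints)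
  finally have "q ^ 2 * comp_sum (2 * p) - q ^ 2 * (3 * comp_sum p) \<in> pideal 3"
    using p_ndvd_2 by (rule pideal_cancel)
  moreover have "1 + 2 = (3 :: nat)" by simp
  ultimately show ?thesis
    using pcong_divide_p[of 1 2 "comp_sum (2 * p)" "3 * comp_sum p"] by (simp only: pcong_def q_def)
qed

text \<open>Knowing \<open>U p\<close> modulo \<open>p\<close> suffices because it enters with the
  factor \<open>p^(r-1)\<close>; the constant is \<open>5/6 * (- 24) = - 20\<close>.\<close>

lemma comp_sum_prime_power_cong:
  assumes "r \<ge> 2"
  shows "pcong r (comp_sum (p ^ r)) (- 20 * of_nat p ^ (r - 1) * bernoulli (p - 5))"
proof -
  have "pcong r (comp_sum (p ^ r)) (of_nat p ^ (r - 1) * (5 / 6 * comp_sum p))"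
    using comp_sum_prime_power[OF comp_sum_2p_cong assms, of 1] by simp
  also have "pcong r \<dots> (of_nat p ^ (r - 1) * (5 / 6 * (- 24 * bernoulli (p - 5))))"
  proof -
    have "5 / 6 * (comp_sum p - - 24 * bernoulli (p - 5)) \<in> pideal 1"
      using comp_sum_p_cong by (intro pideal_mult_integral(1) pints pint_divide_numeral) (simp add: pcong_def)
    then have "of_nat p ^ (r - 1) * (5 / 6 * (comp_sum p - - 24 * bernoulli (p - 5))) \<in> pideal (r - 1 + 1)"
      by (intro pideal_mult p_power_pideal)
    then show ?thesis using assms by (simp add: pcong_def algebra_simps)
  qed
  finally show ?thesis by (simp add: mult_ac)
qed

end

theorem theorem1p1:
  fixes p r :: nat
  assumes "prime p" and "p > 5" and "r \<ge> 2"
  shows "p_integral_cong p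
    (\<Sum>(l1, l2, l3, l4, l5) \<in> {(l1, l2, l3, l4, l5).
        l1 + l2 + l3 + l4 + l5 = p ^ r \<and>
        l1 \<in> prime_to p \<and> l2 \<in> prime_to p \<and> l3 \<in> prime_to p \<and>
        l4 \<in> prime_to p \<and> l5 \<in> prime_to p}.
      1 / (of_nat l1 * of_nat l2 * of_nat l3 * of_nat l4 * of_nat l5))
    (- (fact 5 / 6) * of_nat p ^ (r - 1) * bernoulli (p - 5))
    (of_nat p ^ r)"
proof -
  interpret padic_gt_5 p by unfold_locales fact+
  have *: "- (fact 5 / 6) = (- 20 :: rat)" by (simp add: fact_numeral)
  \<comment> \<open>\<open>B_{p-5}\<close> is integral because \<open>p - 5 < p - 1\<close>.\<close>
  have "- 20 * of_nat p ^ (r - 1) * bernoulli (p - 5) \<in> p_integral p"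
    using \<open>p > 5\<close> by (intro pints bernoulli_integral) auto
  then show ?thesis
    unfolding comp_sum_eq_sum[symmetric] p_integral_cong_iff * using comp_sum_integral comp_sum_prime_power_cong[OF assms(3)] by blast
qed

end
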